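(* Let $m$ be a positive integer and let $f$ be a real-valued locally integrable function on $[0,\infty)$ which is $m$ times continuously differentiable on $(0,\infty)$. Suppose that $f$ has the asymptotic expansion $$f(t)\sim\sum_{j=0}^\infty a_jt^{j-\alpha},\qquad t\to0^+,$$ where $0\le\alpha<1$, and that this expansion can be differentiated $m$ times. Put $$\tilde f(t):=\frac{f(t)-a_0t^{-\alpha}}{t},$$ and suppose moreover that each of the integrals $$\int_1^\infty\tilde f^{(s)}(t)e^{i\omega t}\,dt,\qquad s=0,1,\ldots,m,$$ converges uniformly for $\omega$ sufficiently large. Then, as $\omega\to\infty$, the Hadamard finite-part integral of $e^{i\omega t}f(t)/t$ over $(0,\infty)$ satisfies $$\mathrm{f.p.}\!\int_0^\infty e^{i\omega t}\frac{f(t)}{t}\,dt=\begin{cases}\dfrac{e^{\frac{\pi}{2}(2-\alpha)i}\omega^\alpha}{\alpha}\Gamma(1-\alpha)a_0+\displaystyle\sum_{\ell=1}^{m}a_\ell\, e^{\frac{\pi}{2}(\ell-\alpha)i}\,\frac{\Gamma(\ell-\alpha)}{\omega^{\ell-\alpha}}+o(\omega^{-m}), & \text{if } 0<\alpha<1,\\[3mm] \left(i\dfrac{\pi}{2}-\gamma-\log\omega\right)f(0)+\displaystyle\sum_{\ell=1}^{m}a_\ell\, e^{\frac{\pi\ell}{2}i}\,\frac{(\ell-1)!}{\omega^{\ell}}+o(\omega^{-m}), & \text{if } \alpha=0,\end{cases}$$ where $\gamma$ is the Euler constant.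
   Context: The Hadamard finite-part integral over the half-line is defined by $$\mathrm{f.p.}\!\int_0^\infty F(t)\,dt:=\mathrm{f.p.}\!\int_0^bF(t)\,dt+\int_b^\infty F(t)\,dt,$$ where $b>0$ is arbitrary (the value does not depend on $b$) and the second integral is an improper integral. The finite-part integral over $(0,b)$ is obtained by discarding the divergent terms: if, as $\varepsilon\to0^+$, $$\int_\varepsilon^bF(t)\,dt=\sum_{i}c_i\varepsilon^{-\beta_i}+c\log\varepsilon+C+o(1)$$ with finitely many exponents $\beta_i>0$, then $\mathrm{f.p.}\int_0^bF(t)\,dt:=C$; for convergent integrals this is the usual value. When $\alpha=0$, $f(0)$ denotes $a_0=\lim_{t\to0^+}f(t)$. The expansion $f(t)\sim\sum_j a_jt^{j-\alpha}$ is in the Poincaré sense, and "can be differentiated $m$ times" means that for each $s=0,1,\ldots,m$, $f^{(s)}(t)\sim\sum_{j}a_j\frac{d^s}{dt^s}t^{j-\alpha}$ as $t\to0^+$. "Converges uniformly for $\omega$ sufficiently large" means that there is $\omega_0$ such that the improper integral converges uniformly for $\omega\ge\omega_0$. *)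

theory Defs
  imports "HOL-Analysis.Analysis" "HOL-Real_Asymp.Real_Asymp"
begin

definition locally_integrable_on :: "(real \<Rightarrow> real) \<Rightarrow> real set \<Rightarrow> bool" where
  "locally_integrable_on f S \<longleftrightarrow>
     (\<forall>K. compact K \<and> K \<subseteq> S \<longrightarrow> f absolutely_integrable_on K)"

text \<open>Intended for open \<open>S\<close> only: \<open>deriv\<close> is the two-sided derivative.\<close>
definition times_cont_differentiable_on ::
    "nat \<Rightarrow> (real \<Rightarrow> real) \<Rightarrow> real set \<Rightarrow> bool" where
  "times_cont_differentiable_on m f S \<longleftrightarrow>
     (\<forall>s<m. \<forall>t\<in>S. ((deriv ^^ s) f) field_differentiable (at t)) \<and>
     (\<forall>s\<le>m. continuous_on S ((deriv ^^ s) f))"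

text \<open>
  The Poincare expansion \<open>f(t) \<sim> \<Sum>\<^sub>j a\<^sub>j t\<^bsup>j-\<alpha>\<^esup>\<close> as \<open>t \<rightarrow> 0+\<close>, differentiated \<open>s\<close> times.
  The error of the partial sum up to \<open>j = N\<close> is measured against \<open>t\<^bsup>N-\<alpha>-s\<^esup>\<close>
  and not against the differentiated term itself, because the
  latter vanishes identically when \<open>\<alpha> = 0\<close> and \<open>N < s\<close>.
\<close>
definition diff_expansion_at_0 ::
    "(real \<Rightarrow> real) \<Rightarrow> (nat \<Rightarrow> real) \<Rightarrow> real \<Rightarrow> nat \<Rightarrow> bool" where
  "diff_expansion_at_0 f a \<alpha> s \<longleftrightarrow>
     (\<forall>N. (\<lambda>t. (deriv ^^ s) f t -
               (\<Sum>j\<le>N. a j * (deriv ^^ s) (\<lambda>x. x powr (real j - \<alpha>)) t))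
          \<in> o[at_right 0](\<lambda>t. t powr (real N - \<alpha> - real s)))"

definition has_improper_integral ::
    "(real \<Rightarrow> complex) \<Rightarrow> real \<Rightarrow> complex \<Rightarrow> bool" where
  "has_improper_integral F b J \<longleftrightarrow>
     (\<forall>T\<ge>b. F absolutely_integrable_on {b..T}) \<and>
     ((\<lambda>T. integral {b..T} F) \<longlongrightarrow> J) at_top"

definition improper_integral_uniformly_convergent ::
    "(real \<Rightarrow> real \<Rightarrow> complex) \<Rightarrow> real \<Rightarrow> real set \<Rightarrow> bool" where
  "improper_integral_uniformly_convergent F b \<Omega> \<longleftrightarrow>
     (\<forall>\<omega>\<in>\<Omega>. \<forall>T\<ge>b. F \<omega> absolutely_integrable_on {b..T}) \<and>
     (\<exists>J. uniform_limit \<Omega> (\<lambda>T \<omega>. integral {b..T} (F \<omega>)) J at_top)"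

text \<open>
  Hadamard finite part over \<open>(0,b)\<close>: \<open>B\<close> is the set of exponents \<open>\<beta>\<^sub>i\<close>, and \<open>c \<beta>\<close> is the
  coefficient of \<open>\<epsilon>\<^bsup>-\<beta>\<^esup>\<close>.
\<close>
definition has_fp_integral_0 ::
    "(real \<Rightarrow> complex) \<Rightarrow> real \<Rightarrow> complex \<Rightarrow> bool" where
  "has_fp_integral_0 F b C \<longleftrightarrow>
     (\<forall>\<epsilon>. 0 < \<epsilon> \<and> \<epsilon> < b \<longrightarrow> F absolutely_integrable_on {\<epsilon>..b}) \<and>
     (\<exists>B c k. finite B \<and> (\<forall>\<beta>\<in>B. \<beta> > 0) \<and>
        (\<lambda>\<epsilon>. integral {\<epsilon>..b} F -
              ((\<Sum>\<beta>\<in>B. c \<beta> * of_real (\<epsilon> powr (-\<beta>))) + k * of_real (ln \<epsilon>) + C))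
        \<in> o[at_right 0](\<lambda>_. 1))"

definition has_fp_integral :: "(real \<Rightarrow> complex) \<Rightarrow> complex \<Rightarrow> bool" where
  "has_fp_integral F I \<longleftrightarrow>
     (\<forall>b>0. \<exists>C J. has_fp_integral_0 F b C \<and> has_improper_integral F b J \<and> I = C + J)"

definition fp_integral :: "(real \<Rightarrow> complex) \<Rightarrow> complex" where
  "fp_integral F = (THE I. has_fp_integral F I)"

lemma fp_divergent_terms_unique:
  fixes c :: "real \<Rightarrow> complex"
  assumes "finite B" "\<forall>\<beta>\<in>B. \<beta> > 0"
    and "((\<lambda>\<epsilon>. (\<Sum>\<beta>\<in>B. c \<beta> * of_real (\<epsilon> powr (-\<beta>))) + k * of_real (ln \<epsilon>) + C) \<longlongrightarrow> 0) (at_right 0)"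
  shows "C = 0"
  using assms
proof (induction B rule: finite_linorder_max_induct)
  case empty
  hence lim: "((\<lambda>\<epsilon>. k * of_real (ln \<epsilon>) + C) \<longlongrightarrow> 0) (at_right 0)" by simp
  have inv: "((\<lambda>\<epsilon>. complex_of_real (inverse (ln \<epsilon>))) \<longlongrightarrow> of_real 0) (at_right 0)"
    by (intro tendsto_of_real tendsto_inverse_0_at_top filterlim_compose[OF tendsto_inverse_0]
          filterlim_at_infinity_imp_norm_at_top filterlim_mono[OF ln_at_0 at_bot_le_at_infinity order_refl])
  have ev: "eventually (\<lambda>\<epsilon>::real. ln \<epsilon> \<noteq> 0) (at_right 0)"
    using eventually_at_right_real[of 0 1] by (auto elim!: eventually_mono)
  have "((\<lambda>\<epsilon>. (k * of_real (ln \<epsilon>) + C) * of_real (inverse (ln \<epsilon>)) - C * of_real (inverse (ln \<epsilon>)))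
          \<longlongrightarrow> 0 * of_real 0 - C * of_real 0) (at_right 0)"
    by (intro tendsto_intros lim inv)
  moreover have "eventually (\<lambda>\<epsilon>. (k * of_real (ln \<epsilon>) + C) * of_real (inverse (ln \<epsilon>))
       - C * of_real (inverse (ln \<epsilon>)) = k) (at_right 0)"
    using ev by eventually_elim (simp add: field_simps)
  ultimately have "((\<lambda>_::real. k) \<longlongrightarrow> 0) (at_right 0)"
    by (simp add: tendsto_cong)
  hence "k = 0" by (simp add: tendsto_const_iff)
  with lim show ?case by (simp add: tendsto_const_iff)
next
  case (insert b A)
  have bpos: "b > 0" using insert.prems by auto
  have nb: "b \<notin> A" using insert.hyps by auto
  have z: "((\<lambda>\<epsilon>. complex_of_real (\<epsilon> powr p)) \<longlongrightarrow> of_real 0) (at_right 0)" if "p > 0" for p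
    using that by (intro tendsto_of_real) (real_asymp)
  have zl: "((\<lambda>\<epsilon>. complex_of_real (\<epsilon> powr b * ln \<epsilon>)) \<longlongrightarrow> of_real 0) (at_right 0)"
    using bpos by (intro tendsto_of_real) (real_asymp)
  have S: "((\<lambda>\<epsilon>. \<Sum>\<beta>\<in>A. c \<beta> * of_real (\<epsilon> powr (b - \<beta>))) \<longlongrightarrow> (\<Sum>\<beta>\<in>A. c \<beta> * of_real 0)) (at_right 0)"
    using insert.hyps by (intro tendsto_sum tendsto_mult tendsto_const z) auto
  let ?g = "\<lambda>\<epsilon>. (\<Sum>\<beta>\<in>insert b A. c \<beta> * of_real (\<epsilon> powr (-\<beta>))) + k * of_real (ln \<epsilon>) + C"
  have "((\<lambda>\<epsilon>. ?g \<epsilon> * of_real (\<epsilon> powr b) - (\<Sum>\<beta>\<in>A. c \<beta> * of_real (\<epsilon> powr (b - \<beta>)))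
            - k * of_real (\<epsilon> powr b * ln \<epsilon>) - C * of_real (\<epsilon> powr b))
         \<longlongrightarrow> 0 * of_real 0 - (\<Sum>\<beta>\<in>A. c \<beta> * of_real 0) - k * of_real 0 - C * of_real 0) (at_right 0)"
    by (intro tendsto_diff tendsto_mult insert.prems z bpos S zl tendsto_const)
  moreover have "eventually (\<lambda>\<epsilon>. ?g \<epsilon> * of_real (\<epsilon> powr b)
            - (\<Sum>\<beta>\<in>A. c \<beta> * of_real (\<epsilon> powr (b - \<beta>)))
            - k * of_real (\<epsilon> powr b * ln \<epsilon>) - C * of_real (\<epsilon> powr b) = c b) (at_right 0)"
    using eventually_at_right_less[of 0]
  proof eventually_elim
    case (elim \<epsilon>)
    have 1: "complex_of_real (\<epsilon> powr (-b)) * of_real (\<epsilon> powr b) = 1"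
      using elim by (simp flip: of_real_mult powr_add)
    have 2: "(\<Sum>\<beta>\<in>A. c \<beta> * of_real (\<epsilon> powr (-\<beta>))) * of_real (\<epsilon> powr b)
        = (\<Sum>\<beta>\<in>A. c \<beta> * of_real (\<epsilon> powr (b - \<beta>)))"
      unfolding sum_distrib_right
      by (intro sum.cong refl) (simp add: mult.assoc flip: of_real_mult powr_add)
    have "(\<Sum>\<beta>\<in>insert b A. c \<beta> * of_real (\<epsilon> powr (-\<beta>))) * of_real (\<epsilon> powr b)
        = c b + (\<Sum>\<beta>\<in>A. c \<beta> * of_real (\<epsilon> powr (b - \<beta>)))"
      using nb insert.hyps 1 2 by (simp add: ring_distribs mult.assoc)
    thus ?case by (simp add: ring_distribs mult_ac)
  qed
  ultimately have "((\<lambda>_::real. c b) \<longlongrightarrow> 0) (at_right 0)"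
    by (simp add: tendsto_cong)
  hence "c b = 0" by (simp add: tendsto_const_iff)
  thus ?case using insert nb by simp
qed

lemma has_fp_integral_0_unique:
  assumes "has_fp_integral_0 F b C" "has_fp_integral_0 F b C'"
  shows "C = C'"
proof -
  from assms(1) obtain B c k where 1: "finite B" "\<forall>\<beta>\<in>B. \<beta> > 0"
    "((\<lambda>\<epsilon>. integral {\<epsilon>..b} F -
        ((\<Sum>\<beta>\<in>B. c \<beta> * of_real (\<epsilon> powr (-\<beta>))) + k * of_real (ln \<epsilon>) + C)) \<longlongrightarrow> 0) (at_right 0)"
    unfolding has_fp_integral_0_def by (auto dest!: smalloD_tendsto)
  from assms(2) obtain B' c' k' where 2: "finite B'" "\<forall>\<beta>\<in>B'. \<beta> > 0"
    "((\<lambda>\<epsilon>. integral {\<epsilon>..b} F -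
        ((\<Sum>\<beta>\<in>B'. c' \<beta> * of_real (\<epsilon> powr (-\<beta>))) + k' * of_real (ln \<epsilon>) + C')) \<longlongrightarrow> 0) (at_right 0)"
    unfolding has_fp_integral_0_def by (auto dest!: smalloD_tendsto)
  define d where "d \<beta> = (if \<beta> \<in> B then c \<beta> else 0) - (if \<beta> \<in> B' then c' \<beta> else 0)" for \<beta>
  have s: "(\<Sum>\<beta>\<in>B \<union> B'. d \<beta> * of_real (\<epsilon> powr (-\<beta>))) =
      (\<Sum>\<beta>\<in>B. c \<beta> * of_real (\<epsilon> powr (-\<beta>))) - (\<Sum>\<beta>\<in>B'. c' \<beta> * of_real (\<epsilon> powr (-\<beta>)))" for \<epsilon>
  proof -
    have "(\<Sum>\<beta>\<in>B. c \<beta> * of_real (\<epsilon> powr (-\<beta>)))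
        = (\<Sum>\<beta>\<in>B \<union> B'. (if \<beta> \<in> B then c \<beta> else 0) * of_real (\<epsilon> powr (-\<beta>)))"
      using 1 2 by (intro sum.mono_neutral_cong_left) auto
    moreover have "(\<Sum>\<beta>\<in>B'. c' \<beta> * of_real (\<epsilon> powr (-\<beta>)))
        = (\<Sum>\<beta>\<in>B \<union> B'. (if \<beta> \<in> B' then c' \<beta> else 0) * of_real (\<epsilon> powr (-\<beta>)))"
      using 1 2 by (intro sum.mono_neutral_cong_left) auto
    ultimately show ?thesis
      by (simp add: d_def left_diff_distrib sum_subtractf)
  qed
  have "C - C' = 0"
  proof (rule fp_divergent_terms_unique[of "B \<union> B'" d "k - k'"])
    show "((\<lambda>\<epsilon>. (\<Sum>\<beta>\<in>B \<union> B'. d \<beta> * of_real (\<epsilon> powr (-\<beta>))) + (k - k') * of_real (ln \<epsilon>) + (C - C'))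
            \<longlongrightarrow> 0) (at_right 0)"
      using tendsto_diff[OF 2(3) 1(3)] unfolding s by (simp add: algebra_simps)
  qed (use 1 2 in auto)
  thus ?thesis by simp
qed

lemma has_fp_integral_unique:
  assumes "has_fp_integral F I" "has_fp_integral F I'"
  shows "I = I'"
proof -
  from assms(1) obtain C J where 1: "has_fp_integral_0 F 1 C" "has_improper_integral F 1 J" "I = C + J"
    unfolding has_fp_integral_def by (meson zero_less_one)
  from assms(2) obtain C' J' where 2: "has_fp_integral_0 F 1 C'" "has_improper_integral F 1 J'" "I' = C' + J'"
    unfolding has_fp_integral_def by (meson zero_less_one)
  have "J = J'"
    using 1(2) 2(2) unfolding has_improper_integral_def
    by (auto intro: tendsto_unique[OF trivial_limit_at_top_linorder])
  with has_fp_integral_0_unique[OF 1(1) 2(1)] 1 2 show ?thesis by simp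
qed

lemma fp_integral_eqI: "has_fp_integral F I \<Longrightarrow> fp_integral F = I"
  unfolding fp_integral_def by (blast intro: the_equality has_fp_integral_unique)

end

theory Submission
  imports Defs "HOL-Complex_Analysis.Complex_Analysis"
begin

text \<open>
For \<open>t > 0\<close> the integrand is \<open>e\<^bsup>i\<omega>t\<^esup>\<close> times \<open>a\<^sub>0 t\<^bsup>-\<alpha>-1\<^esup> + g(t)\<close> with \<open>g(t) = (f(t) - a\<^sub>0 t\<^bsup>-\<alpha>\<^esup>) / t\<close>, and \<open>g\<close>
is integrable at \<open>0\<close>. Only the first part needs a finite part, and that finite part is known in
closed form (\<open>leading_finite_part\<close>).

Near \<open>0\<close> write \<open>g = R + \<Sum>\<^sub>l a\<^sub>l t\<^bsup>l-1-\<alpha>\<^esup>\<close> with \<open>1 \<le> l \<le> m\<close>. Differentiability of the expansion makes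
\<open>R\<^sup>(\<^sup>s\<^sup>)(t) = O(t\<^bsup>m-\<alpha>-s\<^esup>)\<close> for \<open>s \<le> m\<close>. Integrate \<open>R\<close> by parts \<open>m\<close> times on \<open>(0,1]\<close>: the boundary terms at \<open>0\<close>
vanish, since \<open>m - \<alpha> - s > 0\<close> for \<open>s < m\<close>, and an integrable \<open>R\<^sup>(\<^sup>m\<^sup>) = O(t\<^bsup>-\<alpha>\<^esup>)\<close> remains. Integrate \<open>g\<close> by parts
\<open>m\<close> times on \<open>[1,\<infinity>)\<close>: the boundary terms at \<open>\<infinity>\<close> vanish, because a function whose oscillatory integral
converges together with that of its derivative tends to \<open>0\<close> (\<open>deriv_chain_vanishes_at_top\<close>). Boundary
terms at \<open>1\<close> survive in both computations; their difference comes from the powers \<open>t\<^bsup>l-1-\<alpha>\<^esup>\<close> alone.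

The powers are treated exactly (\<open>power_tail_limit\<close>). Although the integral of \<open>t\<^bsup>l-1-\<alpha>\<^esup> e\<^bsup>i\<omega>t\<^esup>\<close> over \<open>(0,\<infinity>)\<close>
diverges for \<open>l > 1\<close>, its part over \<open>(0,1)\<close> minus the boundary terms at \<open>1\<close>, plus the \<open>m\<close>-fold integrated
remainder over \<open>(1,\<infinity>)\<close>, equals the Abel value \<open>\<Gamma>(l-\<alpha>) e\<^bsup>i\<pi>(l-\<alpha>)/2\<^esup> \<omega>\<^bsup>\<alpha>-l\<^esup>\<close>, which is the term that the
expansion predicts. On adding up, all boundary terms at \<open>1\<close> cancel, and what is left over is
\<open>(i/\<omega>)\<^sup>m\<close> times a sum of oscillatory integrals of \<open>R\<^sup>(\<^sup>m\<^sup>)\<close> over \<open>(0,1)\<close>, of \<open>g\<^sup>(\<^sup>m\<^sup>)\<close> over \<open>(1,\<infinity>)\<close> and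
of negative powers over \<open>(1,\<infinity>)\<close>. The first tends to \<open>0\<close> by the Riemann-Lebesgue lemma, the second by the
same lemma on \<open>[1,T]\<close> and uniform convergence, the third is \<open>O(1/\<omega>)\<close>. Hence the error is \<open>o(\<omega>\<^bsup>-m\<^esup>)\<close>.

The two closed forms rest on rotating the integral of \<open>z\<^bsup>-\<alpha>\<^esup> e\<^bsup>-z\<^esup>\<close> from the positive real axis to the
negative imaginary axis. Instead of contour integrals, the values of a primitive on the slit plane are
compared at the two ends of quarter circles. For \<open>0 < \<alpha> < 1\<close> this yields the Gamma function at \<open>1 - \<alpha>\<close>;
for the exponent \<open>-1\<close> it yields Euler's constant, through \<open>\<Gamma>(x) - 1/x \<rightarrow> -\<gamma>\<close>, and the small quarter
circle contributes \<open>i\<pi>/2\<close>.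
\<close>

section \<open>Repeated integration by parts against an oscillating factor\<close>

text \<open>
Explicit families of derivatives avoid iterated \<open>deriv\<close>, which is awkward for sums and quotients;
\<open>deriv_chain_unique\<close> leads back to it.
\<close>
definition deriv_chain :: "nat \<Rightarrow> (nat \<Rightarrow> real \<Rightarrow> real) \<Rightarrow> bool" where
  "deriv_chain m u \<longleftrightarrow>
     (\<forall>s<m. \<forall>t>0. (u s has_real_derivative u (Suc s) t) (at t)) \<and> continuous_on {0<..} (u m)"

text \<open>
The primitive that \<open>m\<close> integrations by parts of \<open>u\<^sub>0(t) e\<^bsup>i\<omega>t\<^esup>\<close> produce. Each step contributes
the factor \<open>-1/(i\<omega>) = i/\<omega>\<close>.
\<close>
definition boundary_sum :: "real \<Rightarrow> nat \<Rightarrow> (nat \<Rightarrow> real \<Rightarrow> real) \<Rightarrow> real \<Rightarrow> complex" where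
  "boundary_sum \<omega> m u t = - (\<Sum>s<m. (\<i> / of_real \<omega>) ^ Suc s * of_real (u s t) * cis (\<omega> * t))"

lemma has_vector_derivative_cis:
  "((\<lambda>t. cis (\<omega> * t)) has_vector_derivative \<i> * of_real \<omega> * cis (\<omega> * t)) (at t within S)"
proof -
  have "((\<lambda>z. exp (\<i> * of_real \<omega> * z)) has_field_derivative \<i> * of_real \<omega> * exp (\<i> * of_real \<omega> * of_real t))
          (at (of_real t))"
    by (auto intro!: derivative_eq_intros)
  from has_vector_derivative_real_field[OF this] show ?thesis
    by (simp add: cis_conv_exp mult.assoc)
qed

lemma continuous_on_cis_mult [continuous_intros]: "continuous_on S (\<lambda>t. cis (\<omega> * t))"
  unfolding cis_conv_exp by (intro continuous_intros)

lemma deriv_chain_continuous: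
  assumes "deriv_chain m u" "s \<le> m" shows "continuous_on {0<..} (u s)"
proof (cases "s = m")
  case False
  hence "s < m" using assms by simp
  hence "(u s has_real_derivative u (Suc s) t) (at t within {0<..})" if "t \<in> {0<..}" for t
    using assms that unfolding deriv_chain_def by (auto intro: has_field_derivative_at_within)
  thus ?thesis by (rule DERIV_continuous_on)
qed (use assms in \<open>auto simp: deriv_chain_def\<close>)

lemma deriv_chain_continuous_ivl:
  assumes "deriv_chain m u" "s \<le> m" "0 < x"
  shows "continuous_on {x..y} (\<lambda>t. of_real (u s t) * cis (\<omega> * t))"
proof -
  have "continuous_on {x..y} (u s)"
    using deriv_chain_continuous[OF assms(1,2)] by (rule continuous_on_subset) (use assms(3) in auto)
  thus ?thesis by (intro continuous_intros)
qed

lemma deriv_chain_tail: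
  "deriv_chain (s + n) u \<Longrightarrow> deriv_chain n (\<lambda>i. u (s + i))"
  unfolding deriv_chain_def by simp

lemma deriv_chain_mono:
  assumes "deriv_chain m u" "n \<le> m" shows "deriv_chain n u"
  using assms deriv_chain_continuous[OF assms] unfolding deriv_chain_def by auto

lemma deriv_chain_add_scaled_sum:
  assumes "deriv_chain m u" "\<And>j. j \<in> A \<Longrightarrow> deriv_chain m (v j)"
  shows "deriv_chain m (\<lambda>s t. u s t + (\<Sum>j\<in>A. c j * v j s t))"
  using assms unfolding deriv_chain_def
  by (auto intro!: derivative_eq_intros continuous_intros simp: mult.commute)

text \<open>
The sum telescopes: differentiating the exponential in the term of index \<open>s\<close> gives back the negative of what
differentiating \<open>u\<^sub>s\<^sub>-\<^sub>1\<close> in the preceding term produced.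
\<close>
lemma boundary_sum_deriv:
  assumes "deriv_chain m u" "\<omega> \<noteq> 0" "t > 0"
  shows "(boundary_sum \<omega> m u has_vector_derivative
           (of_real (u 0 t) - (\<i> / of_real \<omega>) ^ m * of_real (u m t)) * cis (\<omega> * t)) (at t)"
  using assms(1)
proof (induction m)
  case 0
  then show ?case by (simp add: boundary_sum_def[abs_def])
next
  case (Suc m)
  let ?q = "(\<i> / of_real \<omega>) :: complex"
  have IH: "(boundary_sum \<omega> m u has_vector_derivative
           (of_real (u 0 t) - ?q ^ m * of_real (u m t)) * cis (\<omega> * t)) (at t)"
    using Suc deriv_chain_mono by simp
  have "(u m has_real_derivative u (Suc m) t) (at t)"
    using Suc.prems assms(3) by (simp add: deriv_chain_def)
  hence "((\<lambda>t. complex_of_real (u m t)) has_vector_derivative of_real (u (Suc m) t)) (at t)"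
    by (rule has_vector_derivative_of_real)
  from has_vector_derivative_mult[OF this has_vector_derivative_cis[of \<omega>]]
  have "((\<lambda>t. ?q ^ Suc m * (complex_of_real (u m t) * cis (\<omega> * t))) has_vector_derivative
          ?q ^ Suc m * (of_real (u m t) * (\<i> * of_real \<omega> * cis (\<omega> * t)) + of_real (u (Suc m) t) * cis (\<omega> * t))) (at t)"
    by (rule has_vector_derivative_mult_right)
  from has_vector_derivative_diff[OF IH this]
  have "((\<lambda>t. boundary_sum \<omega> m u t - ?q ^ Suc m * (complex_of_real (u m t) * cis (\<omega> * t)))
     has_vector_derivative (of_real (u 0 t) - ?q ^ m * of_real (u m t)) * cis (\<omega> * t) -
       ?q ^ Suc m * (of_real (u m t) * (\<i> * of_real \<omega> * cis (\<omega> * t)) + of_real (u (Suc m) t) * cis (\<omega> * t))) (at t)" .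
  moreover have "(\<lambda>t. boundary_sum \<omega> m u t - ?q ^ Suc m * (complex_of_real (u m t) * cis (\<omega> * t)))
      = boundary_sum \<omega> (Suc m) u"
    by (auto simp: boundary_sum_def mult.assoc)
  moreover have "?q ^ Suc m * (\<i> * of_real \<omega>) = - (?q ^ m)"
    using assms(2) by (simp add: field_simps)
  hence "(of_real (u 0 t) - ?q ^ m * of_real (u m t)) * cis (\<omega> * t) -
       ?q ^ Suc m * (of_real (u m t) * (\<i> * of_real \<omega> * cis (\<omega> * t)) + of_real (u (Suc m) t) * cis (\<omega> * t))
     = (of_real (u 0 t) - ?q ^ Suc m * of_real (u (Suc m) t)) * cis (\<omega> * t)"
  proof -
    assume q: "?q ^ Suc m * (\<i> * of_real \<omega>) = - (?q ^ m)"
    have "?q ^ Suc m * (of_real (u m t) * (\<i> * of_real \<omega> * cis (\<omega> * t)))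
        = - (?q ^ m) * of_real (u m t) * cis (\<omega> * t)"
      unfolding q[symmetric] by (simp only: mult_ac)
    thus ?thesis by (simp only: algebra_simps) simp
  qed
  ultimately show ?case by (simp only:)
qed

lemma integral_by_parts_chain:
  assumes "deriv_chain m u" "\<omega> \<noteq> 0" "0 < x" "x \<le> y"
  shows "integral {x..y} (\<lambda>t. of_real (u 0 t) * cis (\<omega> * t)) =
           boundary_sum \<omega> m u y - boundary_sum \<omega> m u x
           + (\<i> / of_real \<omega>) ^ m * integral {x..y} (\<lambda>t. of_real (u m t) * cis (\<omega> * t))"
proof -
  let ?f = "\<lambda>s t. complex_of_real (u s t) * cis (\<omega> * t)"
  have int: "?f s integrable_on {x..y}" if "s \<le> m" for s
    by (intro integrable_continuous_real deriv_chain_continuous_ivl[OF assms(1) that assms(3)])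
  have "((\<lambda>t. (of_real (u 0 t) - (\<i> / of_real \<omega>) ^ m * of_real (u m t)) * cis (\<omega> * t)) has_integral
      boundary_sum \<omega> m u y - boundary_sum \<omega> m u x) {x..y}"
  proof (rule fundamental_theorem_of_calculus[OF assms(4)])
    fix t assume "t \<in> {x..y}"
    hence "t > 0" using assms(3) by simp
    from has_vector_derivative_at_within[OF boundary_sum_deriv[OF assms(1,2) this]]
    show "(boundary_sum \<omega> m u has_vector_derivative
       (of_real (u 0 t) - (\<i> / of_real \<omega>) ^ m * of_real (u m t)) * cis (\<omega> * t)) (at t within {x..y})" .
  qed
  hence "integral {x..y} (\<lambda>t. ?f 0 t - (\<i> / of_real \<omega>) ^ m * ?f m t) = boundary_sum \<omega> m u y - boundary_sum \<omega> m u x"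
    unfolding left_diff_distrib mult.assoc by (rule integral_unique)
  moreover have "integral {x..y} (\<lambda>t. ?f 0 t - (\<i> / of_real \<omega>) ^ m * ?f m t)
      = integral {x..y} (?f 0) - (\<i> / of_real \<omega>) ^ m * integral {x..y} (?f m)"
    using int[of 0] int[of m] by (subst integral_diff) (auto intro: integrable_on_mult_right)
  ultimately have "integral {x..y} (?f 0) - (\<i> / of_real \<omega>) ^ m * integral {x..y} (?f m)
      = boundary_sum \<omega> m u y - boundary_sum \<omega> m u x" by simp
  thus ?thesis by (simp add: diff_eq_eq)
qed

lemma deriv_chain_unique:
  assumes "deriv_chain m u" "\<And>t. t > 0 \<Longrightarrow> f t = u 0 t" "s \<le> m" "t > 0"
  shows "(deriv ^^ s) f t = u s t"
  using assms(3,4)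
proof (induction s arbitrary: t)
  case (Suc s)
  have "((deriv ^^ s) f has_real_derivative u (Suc s) t) (at t)"
  proof (rule has_field_derivative_transform_within_open[where S = "{0<..}" and f = "u s"])
    show "(u s has_real_derivative u (Suc s) t) (at t)"
      using assms(1) Suc.prems by (auto simp: deriv_chain_def)
  qed (use Suc in auto)
  thus ?case using DERIV_imp_deriv by simp
qed (use assms in auto)

lemma boundary_sum_add_scaled_sum:
  "boundary_sum \<omega> m (\<lambda>s t. u s t + (\<Sum>j\<in>A. c j * v j s t)) t
     = boundary_sum \<omega> m u t + (\<Sum>j\<in>A. of_real (c j) * boundary_sum \<omega> m (v j) t)"
proof -
  let ?k = "\<lambda>s. (\<i> / complex_of_real \<omega>) ^ Suc s * cis (\<omega> * t)"
  have b: "boundary_sum \<omega> m w t = - (\<Sum>s<m. ?k s * of_real (w s t))" for w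
    unfolding boundary_sum_def by (intro arg_cong[where f = uminus] sum.cong refl) (simp only: mult_ac)
  have "(\<Sum>s<m. ?k s * of_real (u s t + (\<Sum>j\<in>A. c j * v j s t)))
     = (\<Sum>s<m. ?k s * of_real (u s t)) + (\<Sum>s<m. \<Sum>j\<in>A. of_real (c j) * (?k s * of_real (v j s t)))"
    unfolding sum.distrib[symmetric]
    by (intro sum.cong refl) (simp only: of_real_add of_real_sum of_real_mult distrib_left sum_distrib_left mult_ac)
  also have "(\<Sum>s<m. \<Sum>j\<in>A. of_real (c j) * (?k s * of_real (v j s t)))
     = (\<Sum>j\<in>A. of_real (c j) * (\<Sum>s<m. ?k s * of_real (v j s t)))"
    by (subst sum.swap) (simp only: sum_distrib_left)
  finally show ?thesis unfolding b by (simp add: sum_negf)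
qed

lemma boundary_sum_tendsto_0:
  assumes "\<And>s. s < m \<Longrightarrow> (u s \<longlongrightarrow> 0) F"
  shows "(boundary_sum \<omega> m u \<longlongrightarrow> 0) F"
proof (rule tendsto_norm_zero_cancel, rule Lim_null_comparison)
  show "eventually (\<lambda>t. norm (norm (boundary_sum \<omega> m u t)) \<le> (\<Sum>s<m. norm ((\<i> / of_real \<omega>) ^ Suc s) * \<bar>u s t\<bar>)) F"
  proof (rule always_eventually, rule allI)
    fix t
    have "norm (boundary_sum \<omega> m u t) \<le> (\<Sum>s<m. norm ((\<i> / of_real \<omega>) ^ Suc s * of_real (u s t) * cis (\<omega> * t)))"
      unfolding boundary_sum_def norm_minus_cancel by (rule norm_sum)
    thus "norm (norm (boundary_sum \<omega> m u t)) \<le> (\<Sum>s<m. norm ((\<i> / of_real \<omega>) ^ Suc s) * \<bar>u s t\<bar>)"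
      by (simp only: norm_mult norm_of_real norm_cis mult_1_right real_norm_def abs_norm_cancel)
  qed
  have "((\<lambda>t. \<Sum>s<m. norm ((\<i> / complex_of_real \<omega>) ^ Suc s) * \<bar>u s t\<bar>)
     \<longlongrightarrow> (\<Sum>s<m. norm ((\<i> / complex_of_real \<omega>) ^ Suc s) * 0)) F"
    by (intro tendsto_sum tendsto_mult tendsto_const tendsto_rabs_zero assms) auto
  thus "((\<lambda>t. \<Sum>s<m. norm ((\<i> / complex_of_real \<omega>) ^ Suc s) * \<bar>u s t\<bar>) \<longlongrightarrow> 0) F" by simp
qed

section \<open>Derivatives of powers and of quotients by the variable\<close>

definition powr_deriv :: "real \<Rightarrow> nat \<Rightarrow> real \<Rightarrow> real" where
  "powr_deriv c s t = (\<Prod>i<s. c - real i) * t powr (c - real s)"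

lemma powr_deriv_0 [simp]: "powr_deriv c 0 t = t powr c"
  by (simp add: powr_deriv_def)

lemma powr_deriv_Suc: "powr_deriv (c + 1) (Suc s) t = (c + 1) * powr_deriv c s t"
proof -
  have "(\<Prod>i<Suc s. (c + 1) - real i) = (c + 1) * (\<Prod>i<s. c - real i)"
    by (subst prod.lessThan_Suc_shift) simp
  thus ?thesis by (simp add: powr_deriv_def)
qed

lemma deriv_chain_powr: "deriv_chain m (powr_deriv c)"
  unfolding deriv_chain_def
proof (intro conjI allI impI)
  fix s :: nat and t :: real assume "t > 0"
  from DERIV_cmult[OF has_real_derivative_powr[OF this, of "c - real s"], of "\<Prod>i<s. c - real i"]
  show "(powr_deriv c s has_real_derivative powr_deriv c (Suc s) t) (at t)"
    by (simp add: powr_deriv_def[abs_def] mult.assoc diff_diff_eq add.commute)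
next
  show "continuous_on {0<..} (powr_deriv c m)"
    unfolding powr_deriv_def[abs_def] by (intro continuous_intros) auto
qed

lemma higher_deriv_powr: "t > 0 \<Longrightarrow> (deriv ^^ s) (\<lambda>x. x powr c) t = powr_deriv c s t"
  by (rule deriv_chain_unique[OF deriv_chain_powr _ order_refl]) auto

text \<open>
The derivatives of \<open>Q(t) = h(t)/t\<close>, obtained by solving the Leibniz rule \<open>h\<^sup>(\<^sup>s\<^sup>) = t Q\<^sup>(\<^sup>s\<^sup>) + s Q\<^sup>(\<^sup>s\<^sup>-\<^sup>1\<^sup>)\<close>
for the highest derivative. In this form a bound on the derivatives of \<open>h\<close> passes to those of \<open>Q\<close>
by a one-line induction.
\<close>
primrec quotient_chain :: "(nat \<Rightarrow> real \<Rightarrow> real) \<Rightarrow> nat \<Rightarrow> real \<Rightarrow> real" where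
  "quotient_chain h 0 t = h 0 t / t"
| "quotient_chain h (Suc s) t = (h (Suc s) t - real (Suc s) * quotient_chain h s t) / t"

lemma quotient_chain_deriv:
  assumes "deriv_chain m h" "s < m" "t > 0"
  shows "(quotient_chain h s has_real_derivative quotient_chain h (Suc s) t) (at t)"
  using assms(2)
proof (induction s)
  case 0
  have "(h 0 has_real_derivative h 1 t) (at t)" using assms 0 by (auto simp: deriv_chain_def)
  hence "((\<lambda>t. h 0 t / t) has_real_derivative (h 1 t * t - h 0 t * 1) / (t * t)) (at t)"
    using assms(3) by (intro DERIV_divide DERIV_ident) auto
  moreover have "quotient_chain h 0 = (\<lambda>t. h 0 t / t)" by (rule ext) simp
  moreover have "(h 1 t * t - h 0 t * 1) / (t * t) = quotient_chain h 1 t"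
    using assms(3) by (simp add: field_simps)
  ultimately show ?case by (simp only: One_nat_def)
next
  case (Suc s)
  have "(h (Suc s) has_real_derivative h (Suc (Suc s)) t) (at t)"
    using assms Suc.prems by (auto simp: deriv_chain_def)
  moreover have "(quotient_chain h s has_real_derivative quotient_chain h (Suc s) t) (at t)"
    using Suc by simp
  ultimately have "((\<lambda>t. (h (Suc s) t - real (Suc s) * quotient_chain h s t) / t) has_real_derivative
     ((h (Suc (Suc s)) t - real (Suc s) * quotient_chain h (Suc s) t) * t
        - (h (Suc s) t - real (Suc s) * quotient_chain h s t) * 1) / (t * t)) (at t)"
    using assms(3) by (intro DERIV_divide DERIV_ident DERIV_diff DERIV_cmult) auto
  moreover have "quotient_chain h (Suc s) = (\<lambda>t. (h (Suc s) t - real (Suc s) * quotient_chain h s t) / t)"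
    by (rule ext) simp
  moreover have "((h (Suc (Suc s)) t - real (Suc s) * quotient_chain h (Suc s) t) * t
        - (h (Suc s) t - real (Suc s) * quotient_chain h s t) * 1) / (t * t)
      = quotient_chain h (Suc (Suc s)) t"
  proof -
    have alg: "((H - n * q) * t - (q * t) * 1) / (t * t) = (H - (n + 1) * q) / t" for H n q :: real
    proof -
      have "(H - n * q) * t - (q * t) * 1 = (H - (n + 1) * q) * t" by (simp add: algebra_simps)
      thus ?thesis using assms(3) by simp
    qed
    have e: "h (Suc s) t - real (Suc s) * quotient_chain h s t = quotient_chain h (Suc s) t * t"
      using assms(3) by simp
    show ?thesis unfolding e alg quotient_chain.simps(2)[of h "Suc s"] by (simp add: add.commute)
  qed
  ultimately show ?case by (simp only:)
qed

lemma deriv_chain_quotient: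
  assumes "deriv_chain m h" shows "deriv_chain m (quotient_chain h)"
proof -
  have "continuous_on {0<..} (quotient_chain h s)" if "s \<le> m" for s
    using that
  proof (induction s)
    case 0
    have "continuous_on {0<..} (\<lambda>t. h 0 t / t)"
      using deriv_chain_continuous[OF assms] 0 by (intro continuous_intros) auto
    moreover have "quotient_chain h 0 = (\<lambda>t. h 0 t / t)" by (rule ext) simp
    ultimately show ?case by (simp only:)
  next
    case (Suc s)
    have "continuous_on {0<..} (\<lambda>t. (h (Suc s) t - real (Suc s) * quotient_chain h s t) / t)"
      using deriv_chain_continuous[OF assms] Suc by (intro continuous_intros) auto
    moreover have "quotient_chain h (Suc s) = (\<lambda>t. (h (Suc s) t - real (Suc s) * quotient_chain h s t) / t)"
      by (rule ext) simp
    ultimately show ?case by (simp only:)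
  qed
  thus ?thesis using quotient_chain_deriv[OF assms] by (auto simp: deriv_chain_def simp del: quotient_chain.simps)
qed

lemma ev_nonzero: "eventually (\<lambda>t::real. t \<noteq> 0) (at_right 0)"
  by (rule eventually_mono[OF eventually_at_right_less[of 0]]) auto

lemma quotient_chain_bigo:
  assumes "\<And>s. s \<le> m \<Longrightarrow> h s \<in> O[at_right 0](\<lambda>t. t powr (p - real s))" "s \<le> m"
  shows "quotient_chain h s \<in> O[at_right 0](\<lambda>t. t powr (p - 1 - real s))"
  using assms(2)
proof (induction s)
  case 0
  have "(\<lambda>t. h 0 t / t) \<in> O[at_right 0](\<lambda>t. t powr (p - 0) / t)"
    using assms(1)[of 0] by (intro landau_o.big.divide_right ev_nonzero) auto
  also have "(\<lambda>t::real. t powr (p - 0) / t) \<in> \<Theta>[at_right 0](\<lambda>t. t powr (p - 1))"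
    by (rule bigthetaI_cong, rule eventually_mono[OF eventually_at_right_less[of 0]]) (auto simp: powr_diff)
  finally show ?case by simp
next
  case (Suc s)
  have 1: "h (Suc s) \<in> O[at_right 0](\<lambda>t. t powr (p - 1 - real s))"
    using assms(1)[OF Suc.prems] by (simp add: algebra_simps)
  have 2: "(\<lambda>t. real (Suc s) * quotient_chain h s t) \<in> O[at_right 0](\<lambda>t. t powr (p - 1 - real s))"
    using Suc by (subst landau_o.big.cmult_in_iff) auto
  have "(\<lambda>t. h (Suc s) t - real (Suc s) * quotient_chain h s t) \<in> O[at_right 0](\<lambda>t. t powr (p - 1 - real s))"
    by (rule sum_in_bigo(2)[OF 1 2])
  hence "(\<lambda>t. (h (Suc s) t - real (Suc s) * quotient_chain h s t) / t) \<in> O[at_right 0](\<lambda>t. t powr (p - 1 - real s) / t)"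
    by (intro landau_o.big.divide_right ev_nonzero)
  also have "(\<lambda>t::real. t powr (p - 1 - real s) / t) \<in> \<Theta>[at_right 0](\<lambda>t. t powr (p - 1 - real (Suc s)))"
  proof (rule bigthetaI_cong, rule eventually_mono[OF eventually_at_right_less[of 0]])
    fix t :: real assume "0 < t"
    have "p - 1 - real (Suc s) = p - 1 - real s - 1" by simp
    hence "t powr (p - 1 - real (Suc s)) = t powr (p - 1 - real s - 1)" by (rule arg_cong)
    also have "\<dots> = t powr (p - 1 - real s) / t" using \<open>0 < t\<close> by (subst powr_diff) auto
    finally show "t powr (p - 1 - real s) / t = t powr (p - 1 - real (Suc s))" by (rule sym)
  qed
  finally show ?case by simp
qed

lemma bigo_powr_tendsto_0:
  fixes g :: "real \<Rightarrow> real"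
  assumes "g \<in> O[at_right 0](\<lambda>t. t powr p)" "p > 0"
  shows "(g \<longlongrightarrow> 0) (at_right 0)"
proof -
  obtain C where "eventually (\<lambda>t. norm (g t) \<le> C * norm (t powr p)) (at_right 0)"
    using assms(1) by (elim landau_o.bigE)
  hence "eventually (\<lambda>t. norm (g t) \<le> C * t powr p) (at_right 0)" by simp
  moreover have "((\<lambda>t::real. C * t powr p) \<longlongrightarrow> 0) (at_right 0)" using assms(2) by real_asymp
  ultimately show ?thesis by (rule Lim_null_comparison)
qed

text \<open>
Near \<open>0\<close> this is the hypothesis; on the compact rest of \<open>(0,1]\<close> the function is bounded, and there
\<open>t\<^bsup>-\<alpha>\<^esup> \<ge> 1\<close>.
\<close>
lemma bigo_powr_bound_on_unit:
  fixes g :: "real \<Rightarrow> real"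
  assumes "g \<in> O[at_right 0](\<lambda>t. t powr (-\<alpha>))" "continuous_on {0<..} g" "0 \<le> \<alpha>"
  obtains C where "\<And>t. 0 < t \<Longrightarrow> t \<le> 1 \<Longrightarrow> \<bar>g t\<bar> \<le> C * t powr (-\<alpha>)"
proof -
  obtain C where "eventually (\<lambda>t. norm (g t) \<le> C * norm (t powr (-\<alpha>))) (at_right 0)"
    using assms(1) by (elim landau_o.bigE)
  then obtain d where d: "d > 0" "\<And>t. 0 < t \<Longrightarrow> t < d \<Longrightarrow> \<bar>g t\<bar> \<le> C * t powr (-\<alpha>)"
    by (auto simp: eventually_at_right_field)
  have "compact (g ` {d..1})"
    by (intro compact_continuous_image continuous_on_subset[OF assms(2)]) (use d in auto)
  hence "bounded (g ` {d..1})" by (rule compact_imp_bounded)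
  then obtain B where "\<forall>y\<in>g ` {d..1}. norm y \<le> B" unfolding bounded_iff by blast
  hence B: "\<bar>g t\<bar> \<le> B" if "t \<in> {d..1}" for t using that by simp
  show ?thesis
  proof (rule that[of "max C (max B 0)"])
    fix t :: real assume t: "0 < t" "t \<le> 1"
    show "\<bar>g t\<bar> \<le> max C (max B 0) * t powr (-\<alpha>)"
    proof (cases "t < d")
      case True
      hence "\<bar>g t\<bar> \<le> C * t powr (-\<alpha>)" using d t by simp
      also have "\<dots> \<le> max C (max B 0) * t powr (-\<alpha>)" by (intro mult_right_mono) auto
      finally show ?thesis .
    next
      case False
      have "t powr 0 \<le> t powr (-\<alpha>)" using t assms(3) by (intro powr_mono') auto
      hence p: "1 \<le> t powr (-\<alpha>)" using t by simp
      have "\<bar>g t\<bar> \<le> max C (max B 0) * 1" using B[of t] False t by simp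
      also have "\<dots> \<le> max C (max B 0) * t powr (-\<alpha>)" by (intro mult_left_mono p) auto
      finally show ?thesis .
    qed
  qed
qed

section \<open>Riemann-Lebesgue lemmas and improper oscillatory integrals\<close>

lemma norm_diff_add_le:
  fixes x y z :: "'a::real_normed_vector"
  shows "norm (x - y + z) \<le> norm x + norm y + norm z"
  using norm_triangle_ineq[of "x - y" z] norm_triangle_ineq4[of x y] by linarith

text \<open>
Polynomials are dense in the continuous functions, and for a polynomial a single integration by parts
shows the decay \<open>O(1/\<omega>)\<close>.
\<close>
lemma riemann_lebesgue_continuous:
  fixes g :: "real \<Rightarrow> real"
  assumes "0 < a" "a \<le> b" "continuous_on {a..b} g"
  shows "((\<lambda>\<omega>. integral {a..b} (\<lambda>t. of_real (g t) * cis (\<omega> * t))) \<longlongrightarrow> 0) at_top"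
proof (rule tendstoI)
  fix e :: real assume e: "e > 0"
  \<comment> \<open>The summand 1 keeps the quotient meaningful when a = b.\<close>
  define e' where "e' = e / (2 * (b - a + 1))"
  have e': "e' > 0" "e' * (b - a) < e / 2"
    using e assms(2) by (auto simp: e'_def field_simps)
  obtain p where p: "real_polynomial_function p" "\<And>x. x \<in> {a..b} \<Longrightarrow> \<bar>g x - p x\<bar> < e'"
    using Stone_Weierstrass_real_polynomial_function[OF compact_Icc assms(3) e'(1)] by blast
  obtain p' where p': "real_polynomial_function p'" "\<And>x. (p has_real_derivative p' x) (at x)"
    using has_real_derivative_polynomial_function[OF p(1)] by blast
  have cont: "continuous_on S p" "continuous_on S p'" for S
    using p(1) p'(1) continuous_on_polymonial_function real_polynomial_function_eq by blast+
  define u where "u = (\<lambda>s::nat. if s = 0 then p else p')"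
  have chain: "deriv_chain 1 u"
    using p' cont by (auto simp: deriv_chain_def u_def)
  define M where "M = \<bar>p a\<bar> + \<bar>p b\<bar> + integral {a..b} (\<lambda>t. \<bar>p' t\<bar>)"
  have "((\<lambda>\<omega>::real. M / \<omega>) \<longlongrightarrow> 0) at_top" by real_asymp
  hence "eventually (\<lambda>\<omega>. M / \<omega> < e / 2) at_top"
    using e by (intro order_tendstoD(2)[of _ 0]) auto
  thus "eventually (\<lambda>\<omega>. dist (integral {a..b} (\<lambda>t. of_real (g t) * cis (\<omega> * t))) 0 < e) at_top"
    using eventually_gt_at_top[of 0]
  proof eventually_elim
    case (elim \<omega>)
    let ?I = "\<lambda>u. integral {a..b} (\<lambda>t. complex_of_real (u t) * cis (\<omega> * t))"
    have "?I p = boundary_sum \<omega> 1 u b - boundary_sum \<omega> 1 u a + (\<i> / of_real \<omega>) * ?I p'"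
      using integral_by_parts_chain[OF chain _ assms(1,2), of \<omega>] elim by (simp add: u_def)
    hence "norm (?I p) \<le> norm (boundary_sum \<omega> 1 u b) + norm (boundary_sum \<omega> 1 u a)
        + norm ((\<i> / of_real \<omega>) * ?I p')"
      using norm_diff_add_le by (simp only:)
    also have "norm (boundary_sum \<omega> 1 u b) = \<bar>p b\<bar> / \<omega>"
      using elim by (simp add: boundary_sum_def u_def norm_mult norm_divide)
    also have "norm (boundary_sum \<omega> 1 u a) = \<bar>p a\<bar> / \<omega>"
      using elim by (simp add: boundary_sum_def u_def norm_mult norm_divide)
    also have "norm ((\<i> / of_real \<omega>) * ?I p') = norm (?I p') / \<omega>"
      using elim by (simp add: norm_mult norm_divide)
    also have "norm (?I p') \<le> integral {a..b} (\<lambda>t. \<bar>p' t\<bar>)"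
      by (rule integral_norm_bound_integral)
         (auto intro!: integrable_continuous_real continuous_intros cont simp: norm_mult)
    finally have 1: "norm (?I p) \<le> M / \<omega>"
      using elim by (simp add: M_def add_divide_distrib divide_right_mono)
    have "?I g - ?I p = integral {a..b} (\<lambda>t. of_real (g t) * cis (\<omega> * t) - of_real (p t) * cis (\<omega> * t))"
      by (rule integral_diff[symmetric])
         (auto intro!: integrable_continuous_real continuous_intros cont assms)
    also have "norm \<dots> \<le> e' * (b - a)"
    proof (rule integral_bound[OF assms(2)])
      show "continuous_on {a..b} (\<lambda>t. of_real (g t) * cis (\<omega> * t) - of_real (p t) * cis (\<omega> * t))"
        by (intro continuous_intros cont assms)
      fix t assume t: "t \<in> {a..b}"
      have "norm (of_real (g t) * cis (\<omega> * t) - of_real (p t) * cis (\<omega> * t)) = norm (of_real (g t - p t) * cis (\<omega> * t))"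
        by (simp add: algebra_simps)
      also have "\<dots> = \<bar>g t - p t\<bar>" unfolding norm_mult norm_of_real by simp
      finally show "norm (of_real (g t) * cis (\<omega> * t) - of_real (p t) * cis (\<omega> * t)) \<le> e'"
        using p(2)[OF t] by simp
    qed
    finally have "norm (?I g - ?I p) \<le> e' * (b - a)" .
    hence "norm (?I g) \<le> e' * (b - a) + M / \<omega>"
      using 1 norm_triangle_sub[of "?I g" "?I p"] by linarith
    thus ?case using e'(2) elim by (simp only: dist_norm diff_0_right)
  qed
qed

lemma integrable_singular_at_0:
  fixes g :: "real \<Rightarrow> real"
  assumes "\<alpha> < 1" "continuous_on {0<..1} g" "\<And>t. 0 < t \<Longrightarrow> t \<le> 1 \<Longrightarrow> \<bar>g t\<bar> \<le> C * t powr (-\<alpha>)"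
  shows "(\<lambda>t. of_real (g t) * cis (\<omega> * t)) integrable_on {0..1}"
proof -
  have p: "(\<lambda>t. C * t powr (-\<alpha>)) integrable_on {0<..1}"
  proof (rule integrable_spike_set)
    show "(\<lambda>t. C * t powr (-\<alpha>)) integrable_on {0..1}"
      by (rule integrable_on_mult_right[OF integrable_on_powr_from_0]) (use assms in auto)
  qed (auto intro: negligible_subset[OF negligible_sing[of 0]])
  have "(\<lambda>t. of_real (g t) * cis (\<omega> * t)) absolutely_integrable_on {0<..1}"
  proof (rule measurable_bounded_by_integrable_imp_absolutely_integrable[OF _ _ p])
    show "(\<lambda>t. of_real (g t) * cis (\<omega> * t)) \<in> borel_measurable (lebesgue_on {0<..1})"
      by (intro continuous_imp_measurable_on_sets_lebesgue continuous_intros assms) auto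
  qed (use assms in \<open>auto simp: norm_mult\<close>)
  hence "(\<lambda>t. of_real (g t) * cis (\<omega> * t)) integrable_on {0<..1}"
    by (rule set_lebesgue_integral_eq_integral)
  thus ?thesis
    by (rule integrable_spike_set) (auto intro: negligible_subset[OF negligible_sing[of 0]])
qed

text \<open>
The domination by \<open>C t\<^bsup>-\<alpha>\<^esup>\<close> makes the contribution of \<open>(0,d)\<close> small uniformly in \<open>\<omega>\<close>; on \<open>[d,1]\<close> the
function is continuous.
\<close>
lemma riemann_lebesgue_singular_at_0:
  fixes g :: "real \<Rightarrow> real"
  assumes "\<alpha> < 1" "continuous_on {0<..1} g" "\<And>t. 0 < t \<Longrightarrow> t \<le> 1 \<Longrightarrow> \<bar>g t\<bar> \<le> C * t powr (-\<alpha>)"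
  shows "((\<lambda>\<omega>. integral {0..1} (\<lambda>t. of_real (g t) * cis (\<omega> * t))) \<longlongrightarrow> 0) at_top"
proof (rule tendstoI)
  fix e :: real assume e: "e > 0"
  have "((\<lambda>d. C * (d powr (1 - \<alpha>) / (1 - \<alpha>))) \<longlongrightarrow> C * (0 / (1 - \<alpha>))) (at_right 0)"
    using assms(1) by (intro tendsto_intros) (real_asymp | simp)+
  hence "eventually (\<lambda>d. C * (d powr (1 - \<alpha>) / (1 - \<alpha>)) < e / 2) (at_right 0)"
    using e by (intro order_tendstoD(2)[of _ 0]) auto
  hence "eventually (\<lambda>d. C * (d powr (1 - \<alpha>) / (1 - \<alpha>)) < e / 2 \<and> 0 < d \<and> d < 1) (at_right 0)"
    using eventually_at_right_real[OF zero_less_one] by eventually_elim auto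
  then obtain d where d: "C * (d powr (1 - \<alpha>) / (1 - \<alpha>)) < e / 2" "0 < d" "d < 1"
    using eventually_happens'[OF trivial_limit_at_right_real] by blast
  have "((\<lambda>\<omega>. integral {d..1} (\<lambda>t. of_real (g t) * cis (\<omega> * t))) \<longlongrightarrow> 0) at_top"
    by (rule riemann_lebesgue_continuous) (use d in \<open>auto intro: continuous_on_subset[OF assms(2)]\<close>)
  from tendstoD[OF this, of "e / 2"] e
  have "eventually (\<lambda>\<omega>. norm (integral {d..1} (\<lambda>t. of_real (g t) * cis (\<omega> * t))) < e / 2) at_top"
    by simp
  thus "eventually (\<lambda>\<omega>. dist (integral {0..1} (\<lambda>t. of_real (g t) * cis (\<omega> * t))) 0 < e) at_top"
  proof eventually_elim
    case (elim \<omega>)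
    let ?f = "\<lambda>t. complex_of_real (g t) * cis (\<omega> * t)"
    have int: "?f integrable_on {0..1}" by (rule integrable_singular_at_0[OF assms])
    \<comment> \<open>The pointwise bound may fail at t = 0, so that value is changed first.\<close>
    have "norm (integral {0..d} ?f) = norm (integral {0..d} (\<lambda>t. if t = 0 then 0 else ?f t))"
      by (intro arg_cong[where f = norm] integral_spike[of "{0}"]) auto
    also have "\<dots> \<le> integral {0..d} (\<lambda>t. C * t powr (-\<alpha>))"
    proof (rule integral_norm_bound_integral)
      have "?f integrable_on {0..d}" using int by (rule integrable_on_subinterval) (use d in auto)
      thus "(\<lambda>t. if t = 0 then 0 else ?f t) integrable_on {0..d}"
        by (rule integrable_spike[of _ _ "{0}"]) auto
      show "(\<lambda>t. C * t powr (-\<alpha>)) integrable_on {0..d}"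
        by (rule integrable_on_mult_right[OF integrable_on_powr_from_0]) (use assms d in auto)
    qed (use assms(3) d in \<open>auto simp: norm_mult\<close>)
    also have "\<dots> = C * (d powr (1 - \<alpha>) / (1 - \<alpha>))"
      using has_integral_powr_from_0[of "-\<alpha>" d] assms(1) d(2)
      by (intro integral_unique has_integral_mult_right) (auto simp: algebra_simps)
    finally have "norm (integral {0..d} ?f) < e / 2" using d(1) by linarith
    moreover have "integral {0..1} ?f = integral {0..d} ?f + integral {d..1} ?f"
      using d int by (intro Henstock_Kurzweil_Integration.integral_combine[symmetric]) auto
    ultimately have "norm (integral {0..1} ?f) < e"
      using elim norm_triangle_ineq[of "integral {0..d} ?f" "integral {d..1} ?f"] by (simp only:)
    thus ?case by (simp only: dist_norm diff_0_right)
  qed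
qed

text \<open>
Uniform convergence is what allows the Riemann-Lebesgue lemma to be applied on one interval \<open>[1,T]\<close>
that serves all large \<open>\<omega>\<close>.
\<close>
lemma uniform_improper_integral_vanishes:
  fixes g :: "real \<Rightarrow> real"
  assumes "continuous_on {1..} g"
    and "improper_integral_uniformly_convergent (\<lambda>\<omega> t. of_real (g t) * cis (\<omega> * t)) 1 {\<omega>\<^sub>0..}"
  obtains J where "\<And>\<omega>. \<omega> \<ge> \<omega>\<^sub>0 \<Longrightarrow> ((\<lambda>T. integral {1..T} (\<lambda>t. of_real (g t) * cis (\<omega> * t))) \<longlongrightarrow> J \<omega>) at_top"
    and "(J \<longlongrightarrow> 0) at_top"
proof -
  let ?I = "\<lambda>T \<omega>. integral {1..T} (\<lambda>t. complex_of_real (g t) * cis (\<omega> * t))"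
  from assms(2) obtain J where J: "uniform_limit {\<omega>\<^sub>0..} ?I J at_top"
    unfolding improper_integral_uniformly_convergent_def by blast
  have "(J \<longlongrightarrow> 0) at_top"
  proof (rule tendstoI)
    fix e :: real assume e: "e > 0"
    have "eventually (\<lambda>T. \<forall>\<omega>\<in>{\<omega>\<^sub>0..}. dist (?I T \<omega>) (J \<omega>) < e / 2) at_top"
      using uniform_limitD[OF J, of "e / 2"] e by simp
    then obtain T where T: "T \<ge> 1" "\<And>\<omega>. \<omega> \<ge> \<omega>\<^sub>0 \<Longrightarrow> dist (?I T \<omega>) (J \<omega>) < e / 2"
      unfolding eventually_at_top_linorder by (metis atLeast_iff linorder_linear order_refl)
    have "((\<lambda>\<omega>. ?I T \<omega>) \<longlongrightarrow> 0) at_top"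
      by (rule riemann_lebesgue_continuous) (use T(1) in \<open>auto intro: continuous_on_subset[OF assms(1)]\<close>)
    from tendstoD[OF this, of "e / 2"] e have "eventually (\<lambda>\<omega>. norm (?I T \<omega>) < e / 2) at_top" by simp
    thus "eventually (\<lambda>\<omega>. dist (J \<omega>) 0 < e) at_top"
      using eventually_ge_at_top[of \<omega>\<^sub>0]
    proof eventually_elim
      case (elim \<omega>)
      have "dist (J \<omega>) 0 \<le> dist (?I T \<omega>) (J \<omega>) + dist (?I T \<omega>) 0" by (rule dist_triangle3)
      thus ?case using elim T(2)[of \<omega>] by simp
    qed
  qed
  moreover have "((\<lambda>T. ?I T \<omega>) \<longlongrightarrow> J \<omega>) at_top" if "\<omega> \<ge> \<omega>\<^sub>0" for \<omega>
    using tendsto_uniform_limitI[OF J] that by simp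
  ultimately show ?thesis using that by blast
qed

text \<open>
The integrals over \<open>[T,T+1]\<close> tend to \<open>0\<close> by convergence and to \<open>L\<close> because the integrand does.
\<close>
lemma convergent_integral_limit_zero:
  fixes f :: "real \<Rightarrow> complex"
  assumes cont: "continuous_on {1..} f" and L: "(f \<longlongrightarrow> L) at_top"
    and J: "((\<lambda>T. integral {1..T} f) \<longlongrightarrow> J) at_top"
  shows "L = 0"
proof -
  have "((\<lambda>T. integral {1..T + 1} f) \<longlongrightarrow> J) at_top"
    by (rule filterlim_compose[OF J]) real_asymp
  from tendsto_diff[OF this J]
  have 1: "((\<lambda>T. integral {1..T + 1} f - integral {1..T} f) \<longlongrightarrow> 0) at_top" by simp
  have "((\<lambda>T. integral {1..T + 1} f - integral {1..T} f) \<longlongrightarrow> L) at_top"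
  proof (rule tendstoI)
    fix e :: real assume e: "e > 0"
    have "eventually (\<lambda>T. dist (f T) L < e / 2) at_top" using tendstoD[OF L, of "e / 2"] e by simp
    then obtain T0 where T0: "\<And>t. t \<ge> T0 \<Longrightarrow> dist (f t) L < e / 2"
      unfolding eventually_at_top_linorder by blast
    show "eventually (\<lambda>T. dist (integral {1..T + 1} f - integral {1..T} f) L < e) at_top"
      using eventually_ge_at_top[of "max T0 1"]
    proof eventually_elim
      case (elim T)
      have c: "continuous_on {a..b} f" if "a \<ge> 1" for a b
        using cont by (rule continuous_on_subset) (use that in auto)
      have bound: "norm (integral {T..T+1} (\<lambda>t. f t - L)) \<le> e / 2 * (T + 1 - T)"
        by (intro integral_bound continuous_intros c) (use elim T0 in \<open>auto simp: dist_norm intro: less_imp_le\<close>)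
      have "integral {1..T} f + integral {T..T+1} f = integral {1..T+1} f"
        by (intro Henstock_Kurzweil_Integration.integral_combine integrable_continuous_real c) (use elim in auto)
      moreover have "integral {T..T+1} (\<lambda>t. f t - L) = integral {T..T+1} f - L"
        using c[of T "T + 1"] elim by (subst integral_diff) (auto intro: integrable_continuous_real)
      ultimately have "integral {1..T + 1} f - integral {1..T} f - L = integral {T..T+1} (\<lambda>t. f t - L)"
        by (metis add_diff_cancel_left')
      moreover have "norm (integral {T..T+1} (\<lambda>t. f t - L)) \<le> e / 2"
        using bound by simp
      ultimately have "norm (integral {1..T + 1} f - integral {1..T} f - L) < e"
        using e by auto
      thus ?case by (simp only: dist_norm)
    qed
  qed
  with 1 show ?thesis by (intro tendsto_unique[OF trivial_limit_at_top_linorder])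
qed

text \<open>
One integration by parts expresses \<open>u\<^sub>s(T) e\<^bsup>i\<omega>T\<^esup>\<close> through two convergent integrals, so it has a limit; since its
own integral converges, that limit is \<open>0\<close>. The exponential has modulus one and can be dropped.
\<close>
lemma deriv_chain_vanishes_at_top:
  assumes u: "deriv_chain m u" and \<omega>: "\<omega> \<noteq> 0"
    and conv: "\<And>s. s \<le> m \<Longrightarrow> \<exists>J. ((\<lambda>T. integral {1..T} (\<lambda>t. of_real (u s t) * cis (\<omega> * t))) \<longlongrightarrow> J) at_top"
    and s: "s < m"
  shows "(u s \<longlongrightarrow> 0) at_top"
proof -
  let ?I = "\<lambda>s T. integral {1..T} (\<lambda>t. complex_of_real (u s t) * cis (\<omega> * t))"
  let ?q = "\<i> / complex_of_real \<omega>"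
  let ?b = "boundary_sum \<omega> 1 (\<lambda>i. u (s + i))"
  obtain J J' where J: "(?I s \<longlongrightarrow> J) at_top" and J': "(?I (Suc s) \<longlongrightarrow> J') at_top"
    using conv[of s] conv[of "Suc s"] s by auto
  have chain: "deriv_chain 1 (\<lambda>i. u (s + i))"
    by (rule deriv_chain_tail, rule deriv_chain_mono[OF u]) (use s in auto)
  have "((\<lambda>T. (?b 1 + ?I s T - ?q * ?I (Suc s) T) * - (of_real \<omega> / \<i>))
      \<longlongrightarrow> (?b 1 + J - ?q * J') * - (of_real \<omega> / \<i>)) at_top" (is "(_ \<longlongrightarrow> ?L) _")
    by (intro tendsto_intros J J')
  moreover have "eventually (\<lambda>T. (?b 1 + ?I s T - ?q * ?I (Suc s) T) * - (of_real \<omega> / \<i>)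
      = of_real (u s T) * cis (\<omega> * T)) at_top"
    using eventually_ge_at_top[of 1]
  proof eventually_elim
    case (elim T)
    from integral_by_parts_chain[OF chain \<omega> zero_less_one this]
    have "?I s T = ?b T - ?b 1 + ?q * ?I (Suc s) T" by simp
    hence "?b 1 + ?I s T - ?q * ?I (Suc s) T = ?b T" by simp
    also have "?b T * - (of_real \<omega> / \<i>) = of_real (u s T) * cis (\<omega> * T)"
    proof -
      have "(\<i> / of_real \<omega>) * (of_real \<omega> / \<i>) = (1 :: complex)" using \<omega> by simp
      moreover have "?b T * - (of_real \<omega> / \<i>)
          = (\<i> / of_real \<omega>) * (of_real \<omega> / \<i>) * (of_real (u s T) * cis (\<omega> * T))"
      proof -
        have "?b T = - ((\<i> / of_real \<omega>) * (of_real (u s T) * cis (\<omega> * T)))"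
          by (simp add: boundary_sum_def)
        thus ?thesis by (simp only: minus_mult_minus mult_ac)
      qed
      ultimately show ?thesis by (simp only: mult_1)
    qed
    finally show ?case .
  qed
  ultimately have lim: "((\<lambda>T. of_real (u s T) * cis (\<omega> * T)) \<longlongrightarrow> ?L) at_top"
    by (rule Lim_transform_eventually)
  moreover have "continuous_on {1..} (\<lambda>T. of_real (u s T) * cis (\<omega> * T))"
  proof -
    have "continuous_on {1..} (u s)"
      by (rule continuous_on_subset[OF deriv_chain_continuous[OF u]]) (use s in auto)
    thus ?thesis by (intro continuous_intros)
  qed
  ultimately have "?L = 0" using convergent_integral_limit_zero J by blast
  with lim have "((\<lambda>T. norm (of_real (u s T) * cis (\<omega> * T))) \<longlongrightarrow> 0) at_top"
    by (intro tendsto_norm_zero) (simp only:)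
  hence "((\<lambda>T. \<bar>u s T\<bar>) \<longlongrightarrow> 0) at_top" by (simp add: norm_mult)
  thus ?thesis by (rule tendsto_rabs_zero_cancel)
qed

lemma tendsto_integral_at_right_0:
  fixes f :: "real \<Rightarrow> 'a::banach"
  assumes "f integrable_on {0..1}"
  shows "((\<lambda>x. integral {x..1} f) \<longlongrightarrow> integral {0..1} f) (at_right 0)"
  by (rule continuous_on_Icc_at_rightD[OF indefinite_integral_continuous_1'[OF assms]]) simp

text \<open>
After one integration by parts the oscillating factor multiplies the derivative of \<open>t\<^sup>d\<close>. As \<open>t\<^sup>d\<close> is
monotone, the absolute integral is its total variation \<open>1 - T\<^sup>d\<close>, which cancels against the boundary term at \<open>T\<close>.
\<close>
lemma norm_oscillatory_powr_integral_le:
  assumes "d < 0" "\<omega> > 0" "T \<ge> 1"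
  shows "norm (integral {1..T} (\<lambda>t. of_real (t powr d) * cis (\<omega> * t))) \<le> 2 / \<omega>"
proof -
  let ?I = "\<lambda>s. integral {1..T} (\<lambda>t. complex_of_real (powr_deriv d s t) * cis (\<omega> * t))"
  let ?b = "boundary_sum \<omega> 1 (powr_deriv d)"
  have d1: "powr_deriv d 1 = (\<lambda>t. d * t powr (d - 1))" by (auto simp: powr_deriv_def)
  have "?I 0 = ?b T - ?b 1 + (\<i> / of_real \<omega>) * ?I 1"
    using integral_by_parts_chain[OF deriv_chain_powr[of 1 d] _ zero_less_one assms(3), of \<omega>] assms(2) by simp
  hence "norm (?I 0) \<le> norm (?b T) + norm (?b 1) + norm ((\<i> / of_real \<omega>) * ?I 1)"
    using norm_diff_add_le by (simp only:)
  also have "norm (?b T) = T powr d / \<omega>" using assms by (simp add: boundary_sum_def norm_mult norm_divide)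
  also have "norm (?b 1) = 1 / \<omega>" using assms by (simp add: boundary_sum_def norm_mult norm_divide)
  also have "norm ((\<i> / of_real \<omega>) * ?I 1) = norm (?I 1) / \<omega>"
    using assms by (simp add: norm_mult norm_divide)
  also have "norm (?I 1) \<le> integral {1..T} (\<lambda>t. - d * t powr (d - 1))"
    unfolding d1
    by (rule integral_norm_bound_integral)
       (use assms in \<open>auto intro!: integrable_continuous_real continuous_intros simp: norm_mult abs_mult\<close>)
  also have "integral {1..T} (\<lambda>t. - d * t powr (d - 1)) = 1 - T powr d"
  proof (rule integral_unique)
    have "((\<lambda>t. - d * t powr (d - 1)) has_integral (- (T powr d)) - (- (1 powr d))) {1..T}"
    proof (rule fundamental_theorem_of_calculus[OF assms(3)])
      fix t assume "t \<in> {1..T}"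
      hence "((\<lambda>t. - (t powr d)) has_real_derivative - (d * t powr (d - 1))) (at t within {1..T})"
        by (intro DERIV_minus has_field_derivative_at_within[OF has_real_derivative_powr]) auto
      thus "((\<lambda>t. - (t powr d)) has_vector_derivative - d * t powr (d - 1)) (at t within {1..T})"
        by (simp add: has_real_derivative_iff_has_vector_derivative)
    qed
    thus "((\<lambda>t. - d * t powr (d - 1)) has_integral 1 - T powr d) {1..T}" by simp
  qed
  finally show ?thesis using assms by (simp add: divide_right_mono add_divide_distrib[symmetric])
qed

lemma improper_integral_uniformly_convergent_cong:
  assumes "\<And>\<omega> t. t \<ge> b \<Longrightarrow> F \<omega> t = G \<omega> t"
  shows "improper_integral_uniformly_convergent F b S \<longleftrightarrow> improper_integral_uniformly_convergent G b S"
proof -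
  have "F \<omega> absolutely_integrable_on {b..T} \<longleftrightarrow> G \<omega> absolutely_integrable_on {b..T}" for \<omega> T
    by (rule set_integrable_cong) (use assms in auto)
  moreover have "integral {b..T} (F \<omega>) = integral {b..T} (G \<omega>)" for \<omega> T
    by (rule Henstock_Kurzweil_Integration.integral_cong) (use assms in auto)
  ultimately show ?thesis unfolding improper_integral_uniformly_convergent_def by simp
qed

section \<open>A criterion for Hadamard finite parts\<close>

text \<open>
It suffices to cut at \<open>b = 1\<close>: moving the cut to another \<open>b\<close> shifts a proper integral from one part to the other.
One power and one logarithm are all the divergent terms that occur below.
\<close>
lemma has_fp_integralI:
  fixes F :: "real \<Rightarrow> complex"
  assumes cont: "continuous_on {0<..} F" and \<beta>: "\<beta> > 0"
    and C: "((\<lambda>\<epsilon>. integral {\<epsilon>..1} F - (c * of_real (\<epsilon> powr (-\<beta>)) + k * of_real (ln \<epsilon>))) \<longlongrightarrow> C) (at_right 0)"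
    and J: "((\<lambda>T. integral {1..T} F) \<longlongrightarrow> J) at_top"
  shows "has_fp_integral F (C + J)"
  unfolding has_fp_integral_def
proof (intro allI impI)
  fix b :: real assume b: "b > 0"
  have c: "continuous_on {x..y} F" if "x > 0" for x y
    using cont by (rule continuous_on_subset) (use that in auto)
  have int: "F integrable_on {x..y}" if "x > 0" for x y
    by (intro integrable_continuous_real c that)
  define D where "D = integral {1..b} F - integral {b..1} F"
  have comb: "integral {x..y} F + integral {y..z} F = integral {x..z} F" if "0 < x" "x \<le> y" "y \<le> z" for x y z
    using that by (intro Henstock_Kurzweil_Integration.integral_combine int)
  have triv: "integral {x..y} F = 0" if "x \<ge> y" for x y
    using that by (cases "x = y") auto
  have "has_fp_integral_0 F b (C + D)"
    unfolding has_fp_integral_0_def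
  proof (intro conjI allI impI exI)
    fix \<epsilon> assume "0 < \<epsilon> \<and> \<epsilon> < b"
    thus "F absolutely_integrable_on {\<epsilon>..b}" by (intro absolutely_integrable_continuous_real c) auto
  next
    show "finite {\<beta>}" "\<forall>\<beta>\<in>{\<beta>}. \<beta> > 0" using \<beta> by auto
    have "((\<lambda>\<epsilon>. integral {\<epsilon>..1} F - (c * of_real (\<epsilon> powr (-\<beta>)) + k * of_real (ln \<epsilon>)) - C) \<longlongrightarrow> 0) (at_right 0)"
      using tendsto_diff[OF C tendsto_const[of C]] by simp
    moreover have "eventually (\<lambda>\<epsilon>. integral {\<epsilon>..1} F - (c * of_real (\<epsilon> powr (-\<beta>)) + k * of_real (ln \<epsilon>)) - C
        = integral {\<epsilon>..b} F - ((\<Sum>\<beta>\<in>{\<beta>}. c * of_real (\<epsilon> powr (-\<beta>))) + k * of_real (ln \<epsilon>) + (C + D))) (at_right 0)"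
    proof (rule eventually_mono)
      show "eventually (\<lambda>\<epsilon>. \<epsilon> \<in> {0<..<min 1 b}) (at_right 0)"
        by (rule eventually_at_right_real) (use b in auto)
    next
      fix \<epsilon> assume elim: "\<epsilon> \<in> {0<..<min 1 b}"
      have "integral {\<epsilon>..b} F = integral {\<epsilon>..1} F + D"
        using elim comb[of \<epsilon> 1 b] comb[of \<epsilon> b 1] triv[of 1 b] triv[of b 1]
        by (cases "b \<ge> 1") (auto simp: D_def algebra_simps)
      thus "integral {\<epsilon>..1} F - (c * of_real (\<epsilon> powr (-\<beta>)) + k * of_real (ln \<epsilon>)) - C
        = integral {\<epsilon>..b} F - ((\<Sum>\<beta>\<in>{\<beta>}. c * of_real (\<epsilon> powr (-\<beta>))) + k * of_real (ln \<epsilon>) + (C + D))"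
        by simp
    qed
    ultimately have "((\<lambda>\<epsilon>. integral {\<epsilon>..b} F - ((\<Sum>\<beta>\<in>{\<beta>}. c * of_real (\<epsilon> powr (-\<beta>))) + k * of_real (ln \<epsilon>) + (C + D)))
       \<longlongrightarrow> 0) (at_right 0)"
      by (rule Lim_transform_eventually)
    thus "(\<lambda>\<epsilon>. integral {\<epsilon>..b} F - ((\<Sum>\<beta>\<in>{\<beta>}. c * of_real (\<epsilon> powr (-\<beta>))) + k * of_real (ln \<epsilon>) + (C + D)))
       \<in> o[at_right 0](\<lambda>_. 1)"
      by (intro smalloI_tendsto) auto
  qed
  moreover have "has_improper_integral F b (J - D)"
    unfolding has_improper_integral_def
  proof (intro conjI allI impI)
    fix T assume "b \<le> T"
    show "F absolutely_integrable_on {b..T}" using b by (intro absolutely_integrable_continuous_real c)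
  next
    have "((\<lambda>T. integral {1..T} F - D) \<longlongrightarrow> J - D) at_top" by (intro tendsto_intros J)
    moreover have "eventually (\<lambda>T. integral {1..T} F - D = integral {b..T} F) at_top"
      using eventually_ge_at_top[of "max 1 b"]
    proof eventually_elim
      case (elim T)
      show ?case
        using b elim comb[of 1 b T] comb[of b 1 T] triv[of 1 b] triv[of b 1]
        by (cases "b \<ge> 1") (auto simp: D_def algebra_simps)
    qed
    ultimately show "((\<lambda>T. integral {b..T} F) \<longlongrightarrow> J - D) at_top"
      by (rule Lim_transform_eventually)
  qed
  ultimately show "\<exists>C' J'. has_fp_integral_0 F b C' \<and> has_improper_integral F b J' \<and> C + J = C' + J'"
    by (intro exI[of _ "C + D"] exI[of _ "J - D"]) auto
qed

section \<open>The Gamma integral and its finite part at the pole\<close>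

lemma improper_integral_split_at_1:
  fixes q :: "real \<Rightarrow> real"
  assumes "q absolutely_integrable_on {0..}"
  obtains r s where "((\<lambda>x. integral {x..1} q) \<longlongrightarrow> r) (at_right 0)"
    "((\<lambda>T. integral {1..T} q) \<longlongrightarrow> s) at_top" "r + s = integral {0..} q"
proof
  have 1: "q absolutely_integrable_on {1..}" 
    by (rule set_integrable_subset[OF assms]) auto
  have 0: "q absolutely_integrable_on {0..1}" 
    by (rule set_integrable_subset[OF assms]) auto
  have "continuous_on {0..1} (\<lambda>x. integral {x..1} q)"
    by (intro indefinite_integral_continuous_1' set_lebesgue_integral_eq_integral 0)
  thus "((\<lambda>x. integral {x..1} q) \<longlongrightarrow> integral {0..1} q) (at_right 0)"
    by (rule continuous_on_Icc_at_rightD) simp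
  have "((\<lambda>T. set_lebesgue_integral lebesgue {1..T} q) \<longlongrightarrow> set_lebesgue_integral lebesgue {1..} q) at_top"
    by (rule tendsto_set_lebesgue_integral_at_top[OF _ 1]) auto
  moreover have "set_lebesgue_integral lebesgue {1..T} q = integral {1..T} q" for T
    by (rule set_lebesgue_integral_eq_integral, rule set_integrable_subset[OF 1]) auto
  moreover have "set_lebesgue_integral lebesgue {1..} q = integral {1..} q"
    by (rule set_lebesgue_integral_eq_integral[OF 1])
  ultimately show "((\<lambda>T. integral {1..T} q) \<longlongrightarrow> integral {1..} q) at_top" by simp
  have "{0..1} \<inter> {1..} = {1::real}" by auto
  hence "integral ({0..1} \<union> {1..}) q = integral {0..1} q + integral {1..} q"
    using set_lebesgue_integral_eq_integral(1)[OF 0] set_lebesgue_integral_eq_integral(1)[OF 1]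
    by (intro integral_Un) auto
  moreover have "{0..1} \<union> {1..} = {0::real..}" by auto
  ultimately show "integral {0..1} q + integral {1..} q = integral {0..} q" by simp
qed

lemma Gamma_integral_split_at_1:
  fixes \<alpha> :: real
  assumes "\<alpha> < 1"
  obtains r s where "((\<lambda>x. integral {x..1} (\<lambda>t. t powr (-\<alpha>) * exp (-t))) \<longlongrightarrow> r) (at_right 0)"
    "((\<lambda>T. integral {1..T} (\<lambda>t. t powr (-\<alpha>) * exp (-t))) \<longlongrightarrow> s) at_top" "r + s = Gamma (1 - \<alpha>)"
proof -
  have I: "((\<lambda>t. t powr (-\<alpha>) * exp (-t)) has_integral Gamma (1 - \<alpha>)) {0..}"
    using Gamma_integral_real[of "1 - \<alpha>"] assms by (simp add: exp_minus divide_inverse)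
  hence A: "(\<lambda>t. t powr (-\<alpha>) * exp (-t)) absolutely_integrable_on {0..}"
    by (intro nonnegative_absolutely_integrable_1) auto
  show ?thesis
    by (rule improper_integral_split_at_1[OF A]) (rule that, simp_all add: integral_unique[OF I])
qed

text \<open>
For \<open>x > 0\<close> the function \<open>t\<^bsup>x-1\<^esup> (e\<^bsup>-t\<^esup> - 1\<^sub>[\<^sub>t\<^sub>\<le>\<^sub>1\<^sub>])\<close> has integral \<open>\<Gamma>(x) - 1/x = (\<Gamma>(1+x) - \<Gamma>(1))/x\<close>. As \<open>x \<rightarrow> 0\<close> the
right-hand side tends to \<open>\<Gamma>'(1) = -\<gamma>\<close>, and dominated convergence identifies the limit of the left-hand side.
\<close>
lemma euler_mascheroni_integral:
  defines "k \<equiv> (\<lambda>t::real. (exp (-t) - (if t \<le> 1 then 1 else 0)) / t)"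
  shows "k absolutely_integrable_on {0..}" "integral {0..} k = - euler_mascheroni"
proof -
  define x :: "nat \<Rightarrow> real" where "x n = 1 / real (Suc n)" for n
  have x: "0 < x n" "x n \<le> 1" for n by (auto simp: x_def)
  have x_lim: "x \<longlonglongrightarrow> 0" unfolding x_def by real_asymp
  define f where "f n t = t powr (x n - 1) * (exp (-t) - (if t \<le> 1 then 1 else 0))" for n t
  define h where "h t = exp (-t) + (if t \<in> {0..1} then 1 else 0 :: real)" for t :: real
  have f_int: "(f n has_integral Gamma (x n) - 1 / x n) {0..}" for n
  proof -
    have "((\<lambda>t. if t \<in> {0..1} then t powr (x n - 1) else 0) has_integral 1 powr (x n - 1 + 1) / (x n - 1 + 1)) {0..}"
      by (subst has_integral_restrict, simp, rule has_integral_powr_from_0) (use x[of n] in auto)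
    from has_integral_diff[OF Gamma_integral_real[OF x(1)[of n]] this]
    have "((\<lambda>t. t powr (x n - 1) / exp t - (if t \<in> {0..1} then t powr (x n - 1) else 0)) has_integral Gamma (x n) - 1 / x n) {0..}"
      by simp
    thus ?thesis
      by (rule has_integral_eq[rotated]) (auto simp: f_def exp_minus field_simps)
  qed
  have h_int: "h integrable_on {0..}"
  proof -
    have "(\<lambda>t::real. exp (-t)) integrable_on {0..}" using integrable_on_exp_minus_to_infinity[of 1 0] by simp
    moreover have "(\<lambda>t::real. if t \<in> {0..1} then 1 else 0 :: real) integrable_on {0..}"
    proof (subst integrable_restrict_Int)
      have e: "{0..1} \<inter> {0::real..} = {0..1}" by auto
      show "(\<lambda>t::real. 1 :: real) integrable_on {0..1} \<inter> {0..}" unfolding e by (rule integrable_const_ivl)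
    qed
    ultimately show ?thesis unfolding h_def[abs_def] by (rule integrable_add)
  qed
  have bound: "norm (t powr p * (exp (-t) - (if t \<le> 1 then 1 else 0))) \<le> h t"
    if "t \<in> {0..}" "-1 \<le> p" "p \<le> 0" for t p
  proof (cases "t = 0")
    case False
    hence t: "t > 0" using that by auto
    show ?thesis
    proof (cases "t \<le> 1")
      case True
      have e: "\<bar>exp (-t) - 1\<bar> \<le> t" using exp_ge_add_one_self[of "-t"] t by (simp add: abs_if)
      have "norm (t powr p * (exp (-t) - 1)) = t powr p * \<bar>exp (-t) - 1\<bar>" by (simp add: abs_mult)
      also have "\<dots> \<le> t powr p * t" by (intro mult_left_mono e) auto
      also have "\<dots> = t powr (p + 1)" using t by (simp add: powr_add)
      also have "\<dots> \<le> 1" using t True that by (intro powr_le1) auto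
      finally show ?thesis using t True by (simp add: h_def add_increasing)
    next
      case False
      have "t powr p \<le> 1" using False that powr_mono[of p 0 t] by simp
      thus ?thesis using False by (auto simp: h_def abs_mult intro: mult_left_le_one_le)
    qed
  qed (simp add: h_def)
  have k_eq: "k t = t powr (-1) * (exp (-t) - (if t \<le> 1 then 1 else 0))" if "t \<in> {0..}" for t
    using that by (auto simp: k_def powr_minus divide_inverse powr_one)
  \<comment> \<open>At t = 0 both sides are 0 by the conventions for powr and division.\<close>
  have f_lim: "(\<lambda>n. f n t) \<longlonglongrightarrow> k t" if "t \<in> {0..}" for t
  proof (cases "t = 0")
    case False
    hence "t > 0" using that by auto
    have "(\<lambda>n. f n t) \<longlonglongrightarrow> t powr (0 - 1) * (exp (-t) - (if t \<le> 1 then 1 else 0))"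
      unfolding f_def by (intro tendsto_intros x_lim) (use \<open>t > 0\<close> in auto)
    thus ?thesis using k_eq[OF that] by simp
  qed (simp add: f_def k_def)
  have f_bound: "norm (f n t) \<le> h t" if "t \<in> {0..}" for n t
    unfolding f_def using bound[OF that, of "x n - 1"] x[of n] by simp
  have dc: "k integrable_on {0..}" "(\<lambda>n. integral {0..} (f n)) \<longlonglongrightarrow> integral {0..} k"
    by (rule dominated_convergence[OF has_integral_integrable[OF f_int] h_int f_bound f_lim]; assumption)+
  show "k absolutely_integrable_on {0..}"
  proof (rule absolutely_integrable_integrable_bound[OF _ dc(1) h_int])
    fix t :: real assume "t \<in> {0..}"
    thus "norm (k t) \<le> h t" unfolding k_eq[OF \<open>t \<in> {0..}\<close>] by (intro bound) auto
  qed
  have "(Gamma has_real_derivative - euler_mascheroni) (at 1)"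
    using has_field_derivative_Gamma[of "1::real" UNIV] by simp
  hence "((\<lambda>h::real. (Gamma (1 + h) - Gamma 1) / h) \<longlongrightarrow> - euler_mascheroni) (at 0)"
    by (simp add: DERIV_def)
  moreover have "filterlim x (at 0) sequentially"
    using x_lim less_imp_neq[OF x(1), symmetric] by (simp add: filterlim_at)
  ultimately have "(\<lambda>n. (Gamma (1 + x n) - Gamma 1) / x n) \<longlonglongrightarrow> - euler_mascheroni"
    by (rule filterlim_compose)
  moreover have "(Gamma (1 + x n) - Gamma 1) / x n = integral {0..} (f n)" for n
  proof -
    have "x n \<notin> \<int>\<^sub>\<le>\<^sub>0" using x(1)[of n] nonpos_Ints_nonpos[of "x n"] by auto
    hence "Gamma (1 + x n) = x n * Gamma (x n)"
      using Gamma_plus1[of "x n"] by (simp add: add.commute)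
    thus ?thesis using x(1)[of n] integral_unique[OF f_int[of n]] by (simp add: field_simps)
  qed
  ultimately have "(\<lambda>n. integral {0..} (f n)) \<longlonglongrightarrow> - euler_mascheroni" by simp
  with dc(2) show "integral {0..} k = - euler_mascheroni" by (rule LIMSEQ_unique)
qed

text \<open>
The subtraction of \<open>1\<close> on \<open>(0,1]\<close> in \<open>euler_mascheroni_integral\<close> amounts to the regularising logarithm.
\<close>
lemma exponential_integral_split_at_1:
  obtains r s :: real where "((\<lambda>x. integral {x..1} (\<lambda>t. t powr (-1) * exp (-t)) + ln x) \<longlongrightarrow> r) (at_right 0)"
    "((\<lambda>T. integral {1..T} (\<lambda>t. t powr (-1) * exp (-t))) \<longlongrightarrow> s) at_top" "r + s = - euler_mascheroni"
proof -
  let ?k = "\<lambda>t::real. (exp (-t) - (if t \<le> 1 then 1 else 0)) / t"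
  let ?q = "\<lambda>t::real. t powr (-1) * exp (-t)"
  obtain r s where rs: "((\<lambda>x. integral {x..1} ?k) \<longlongrightarrow> r) (at_right 0)"
    "((\<lambda>T. integral {1..T} ?k) \<longlongrightarrow> s) at_top" "r + s = - euler_mascheroni"
    by (rule improper_integral_split_at_1[OF euler_mascheroni_integral(1)])
       (simp only: euler_mascheroni_integral(2))
  have q: "?q t = exp (-t) / t" if "t > 0" for t using that by (simp add: powr_minus divide_inverse)
  have "eventually (\<lambda>x. integral {x..1} ?k = integral {x..1} ?q + ln x) (at_right 0)"
    using eventually_at_right_real[OF zero_less_one]
  proof eventually_elim
    case (elim x)
    have "((\<lambda>t. 1 / t) has_integral ln 1 - ln x) {x..1}"
    proof (rule fundamental_theorem_of_calculus)
      fix t assume "t \<in> {x..1}"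
      hence "t > 0" using elim by auto
      from DERIV_ln_divide[OF this] show "(ln has_vector_derivative 1 / t) (at t within {x..1})"
        by (simp add: has_field_derivative_at_within has_real_derivative_iff_has_vector_derivative[symmetric])
    qed (use elim in auto)
    moreover have "(\<lambda>t::real. exp (-t) / t) integrable_on {x..1}"
      by (intro integrable_continuous_real continuous_intros) (use elim in auto)
    ultimately have "integral {x..1} (\<lambda>t. exp (-t) / t - 1 / t) = integral {x..1} (\<lambda>t. exp (-t) / t) + ln x"
      by (subst integral_diff) (auto simp: integral_unique has_integral_integrable)
    moreover have "integral {x..1} ?k = integral {x..1} (\<lambda>t. exp (-t) / t - 1 / t)"
      by (rule Henstock_Kurzweil_Integration.integral_cong) (auto simp: diff_divide_distrib)
    moreover have "integral {x..1} ?q = integral {x..1} (\<lambda>t. exp (-t) / t)"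
      by (rule Henstock_Kurzweil_Integration.integral_cong) (use elim q in auto)
    ultimately show ?case by simp
  qed
  hence "((\<lambda>x. integral {x..1} ?q + ln x) \<longlongrightarrow> r) (at_right 0)"
    using rs(1) by (rule Lim_transform_eventually[rotated])
  moreover have "integral {1..T} ?k = integral {1..T} ?q" for T
  proof (rule integral_spike[of "{1}"])
    fix t assume "t \<in> {1..T} - {1}"
    thus "?q t = ?k t" using q[of t] by auto
  qed auto
  hence "((\<lambda>T. integral {1..T} ?q) \<longlongrightarrow> s) at_top" using rs(2) by simp
  ultimately show ?thesis using that rs(3) by blast
qed

section \<open>Rotating the Gamma integral onto the imaginary axis\<close>

lemma cos_ge_linear:
  assumes "0 \<le> \<theta>" "\<theta> \<le> pi / 2" shows "cos \<theta> \<ge> 1 - 2 * \<theta> / pi"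
proof -
  have "convex_on {0..pi/2} (\<lambda>x. - cos x)"
  proof (rule convex_on_realI)
    fix x y :: real assume "x \<in> {0..pi/2}" "y \<in> {0..pi/2}" "x \<le> y"
    thus "sin x \<le> sin y" by (intro sin_monotone_2pi_le) auto
  qed (auto intro!: derivative_eq_intros)
  from convex_onD_Icc[OF this, of "2 * \<theta> / pi"] assms show ?thesis
    by (simp add: field_simps)
qed

text \<open>
The mean value inequality on the left half-plane, where \<open>exp\<close> is bounded by \<open>1\<close>.
\<close>
lemma norm_exp_minus_1_le:
  fixes w :: complex
  assumes "Re w \<le> 0" shows "norm (exp w - 1) \<le> norm w"
proof -
  have "norm (exp w - exp 0) \<le> 1 * norm (w - 0)"
  proof (rule field_differentiable_bound[of "{z. Re z \<le> 0}" exp exp])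
    show "convex {z. Re z \<le> 0}" by (rule convex_halfspace_Re_le)
  qed (use assms in \<open>auto intro!: derivative_eq_intros\<close>)
  thus ?thesis by simp
qed

lemma powr_minus_imaginary_axis:
  assumes "r > 0"
  shows "(- \<i> * complex_of_real r) powr (- complex_of_real \<alpha>) = of_real (r powr (-\<alpha>)) * cis (pi / 2 * \<alpha>)"
proof -
  have "Ln (of_real r * (-\<i>)) = of_real (ln r) + Ln (-\<i>)"
    using Ln_times_of_real[OF assms, of "-\<i>"] Ln_of_real[OF assms] by simp
  hence L: "Ln (- \<i> * of_real r) = of_real (ln r) - \<i> * of_real (pi / 2)"
    by (simp add: mult.commute)
  have "(- \<i> * complex_of_real r) powr (- complex_of_real \<alpha>) = exp (- of_real \<alpha> * Ln (- \<i> * of_real r))"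
    using assms by (simp add: powr_def)
  also have "\<dots> = exp (of_real (- \<alpha> * ln r) + \<i> * of_real (pi / 2 * \<alpha>))"
    unfolding L by (simp add: algebra_simps)
  also have "\<dots> = of_real (exp (- \<alpha> * ln r)) * cis (pi / 2 * \<alpha>)"
    by (simp only: exp_add cis_conv_exp exp_of_real)
  also have "exp (- \<alpha> * ln r) = r powr (-\<alpha>)" using assms by (simp add: powr_def)
  finally show ?thesis .
qed

text \<open>
A primitive of \<open>z\<^bsup>-\<alpha>\<^esup> e\<^bsup>-z\<^esup>\<close> on the plane slit along the non-positive reals. Integrals along the two axes
are differences of its values, so that rotating the path of integration reduces to comparing
\<open>P(r)\<close> and \<open>P(-ir)\<close> for large and for small \<open>r\<close>.
\<close>
locale gamma_primitive =
  fixes \<alpha> :: real and P :: "complex \<Rightarrow> complex"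
  assumes P: "\<And>z. z \<notin> \<real>\<^sub>\<le>\<^sub>0 \<Longrightarrow>
    (P has_field_derivative z powr (- complex_of_real \<alpha>) * exp (- z)) (at z)"
begin

lemma arc_avoids_slit:
  assumes "r > 0" "0 \<le> \<theta>" "\<theta> \<le> pi / 2" shows "of_real r * cis (- \<theta>) \<notin> \<real>\<^sub>\<le>\<^sub>0"
proof
  assume "of_real r * cis (- \<theta>) \<in> \<real>\<^sub>\<le>\<^sub>0"
  hence "r * cos \<theta> \<le> 0" "r * sin \<theta> = 0" by (auto simp: complex_nonpos_Reals_iff)
  hence "cos \<theta> \<le> 0" "sin \<theta> = 0" using assms(1) by (auto simp: mult_le_0_iff)
  moreover have "cos \<theta> \<ge> 0" using assms by (intro cos_ge_zero) auto
  ultimately show False using sin_cos_squared_add[of \<theta>] by simp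
qed

lemma arc_derivative:
  assumes "r > 0" "0 \<le> \<theta>" "\<theta> \<le> pi / 2"
  shows "((\<lambda>\<theta>. P (of_real r * cis (- \<theta>))) has_vector_derivative
      (of_real r * cis (- \<theta>)) powr (- complex_of_real \<alpha>) * exp (- (of_real r * cis (- \<theta>)))
        * (- \<i> * (of_real r * cis (- \<theta>)))) (at \<theta>)"
proof -
  have "((\<lambda>\<theta>. complex_of_real r * cis (-1 * \<theta>)) has_vector_derivative
      of_real r * (\<i> * of_real (-1) * cis (-1 * \<theta>))) (at \<theta>)"
    by (intro has_vector_derivative_mult_right has_vector_derivative_cis)
  hence "((\<lambda>\<theta>. of_real r * cis (- \<theta>)) has_vector_derivative (- \<i> * (of_real r * cis (- \<theta>)))) (at \<theta>)"
    by (simp add: mult_ac)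
  from field_vector_diff_chain_at[OF this P[OF arc_avoids_slit[OF assms]]] show ?thesis
    by (simp add: o_def mult_ac)
qed

lemma norm_arc_derivative:
  assumes "r > 0"
  shows "norm ((of_real r * cis (- \<theta>)) powr (- complex_of_real \<alpha>) * exp (- (of_real r * cis (- \<theta>)))
        * (- \<i> * (of_real r * cis (- \<theta>)))) = r powr (1 - \<alpha>) * exp (- r * cos \<theta>)"
proof -
  have "norm ((of_real r * cis (- \<theta>)) powr (- complex_of_real \<alpha>)) = r powr (-\<alpha>)"
    using assms by (subst norm_powr_real_powr') (auto simp: norm_mult)
  thus ?thesis using assms by (simp add: norm_mult powr_diff powr_minus divide_inverse)
qed

lemma arc_continuous:
  assumes "r > 0" shows "continuous_on {0..pi/2} (\<lambda>\<theta>. P (of_real r * cis (- \<theta>)))"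
  using arc_derivative[OF assms]
  by (intro continuous_on_vector_derivative) (auto intro: has_vector_derivative_at_within)

text \<open>
Jordan's inequality \<open>cos \<theta> \<ge> 1 - 2\<theta>/\<pi>\<close> gains the factor \<open>1/r\<close> that compensates the length of the arc.
The bound is therefore useful for \<open>\<alpha> > 0\<close>.
\<close>
lemma large_arc_bound:
  assumes "r > 0"
  shows "norm (P (- \<i> * of_real r) - P (of_real r)) \<le> pi / 2 * r powr (-\<alpha>)"
proof -
  \<comment> \<open>A primitive of the majorant that the linear lower bound for the cosine provides.\<close>
  define \<phi> where "\<phi> \<theta> = pi / (2 * r) * r powr (1 - \<alpha>) * exp (- r * (1 - 2 * \<theta> / pi))" for \<theta>
  have "norm (P (of_real r * cis (- (pi / 2))) - P (of_real r * cis (- 0))) \<le> \<phi> (pi / 2) - \<phi> 0"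
  proof (rule differentiable_bound_general[OF _ arc_continuous[OF assms]])
    fix \<theta> :: real assume \<theta>: "0 < \<theta>" "\<theta> < pi / 2"
    show "((\<lambda>\<theta>. P (of_real r * cis (- \<theta>))) has_vector_derivative
      (of_real r * cis (- \<theta>)) powr (- complex_of_real \<alpha>) * exp (- (of_real r * cis (- \<theta>)))
        * (- \<i> * (of_real r * cis (- \<theta>)))) (at \<theta>)"
      by (rule arc_derivative) (use \<theta> assms in auto)
    have "(\<phi> has_real_derivative r powr (1 - \<alpha>) * exp (- r * (1 - 2 * \<theta> / pi))) (at \<theta>)"
      unfolding \<phi>_def[abs_def] using assms by (auto intro!: derivative_eq_intros)
    thus "(\<phi> has_vector_derivative r powr (1 - \<alpha>) * exp (- r * (1 - 2 * \<theta> / pi))) (at \<theta>)"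
      by (simp add: has_real_derivative_iff_has_vector_derivative)
    show "norm ((of_real r * cis (- \<theta>)) powr (- complex_of_real \<alpha>) * exp (- (of_real r * cis (- \<theta>)))
        * (- \<i> * (of_real r * cis (- \<theta>)))) \<le> r powr (1 - \<alpha>) * exp (- r * (1 - 2 * \<theta> / pi))"
      unfolding norm_arc_derivative[OF assms] using cos_ge_linear[of \<theta>] \<theta> assms
      by (intro mult_left_mono) auto
  next
    show "continuous_on {0..pi / 2} \<phi>" unfolding \<phi>_def by (intro continuous_intros) auto
  qed auto
  also have "\<phi> (pi / 2) - \<phi> 0 \<le> \<phi> (pi / 2)" using assms by (simp add: \<phi>_def)
  also have "\<phi> (pi / 2) = pi / 2 * r powr (-\<alpha>)"
  proof -
    have "r powr (1 - \<alpha>) = r * r powr (-\<alpha>)" using assms powr_add[of r 1 "-\<alpha>"] by simp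
    thus ?thesis using assms by (simp add: \<phi>_def)
  qed
  finally show ?thesis by (simp add: mult.commute)
qed

lemma small_arc_bound:
  assumes "r > 0"
  shows "norm (P (- \<i> * of_real r) - P (of_real r)) \<le> pi / 2 * r powr (1 - \<alpha>)"
proof -
  have "norm (P (of_real r * cis (- (pi / 2))) - P (of_real r * cis (- 0)))
      \<le> r powr (1 - \<alpha>) * (pi / 2) - r powr (1 - \<alpha>) * 0"
  proof (rule differentiable_bound_general[OF _ arc_continuous[OF assms]])
    fix \<theta> :: real assume \<theta>: "0 < \<theta>" "\<theta> < pi / 2"
    show "((\<lambda>\<theta>. P (of_real r * cis (- \<theta>))) has_vector_derivative
      (of_real r * cis (- \<theta>)) powr (- complex_of_real \<alpha>) * exp (- (of_real r * cis (- \<theta>)))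
        * (- \<i> * (of_real r * cis (- \<theta>)))) (at \<theta>)"
      by (rule arc_derivative) (use \<theta> assms in auto)
    show "((\<lambda>\<theta>. r powr (1 - \<alpha>) * \<theta>) has_vector_derivative r powr (1 - \<alpha>)) (at \<theta>)"
      unfolding has_real_derivative_iff_has_vector_derivative[symmetric]
      by (auto intro!: derivative_eq_intros)
    have "cos \<theta> \<ge> 0" using \<theta> by (intro cos_ge_zero) auto
    thus "norm ((of_real r * cis (- \<theta>)) powr (- complex_of_real \<alpha>) * exp (- (of_real r * cis (- \<theta>)))
        * (- \<i> * (of_real r * cis (- \<theta>)))) \<le> r powr (1 - \<alpha>)"
      unfolding norm_arc_derivative[OF assms] using assms by (intro mult_right_le_one_le) auto
  qed (auto intro!: continuous_intros)
  thus ?thesis by (simp add: mult.commute)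
qed

text \<open>
Along the arc \<open>1/z\<close> alone integrates to \<open>-i\<pi>/2\<close>, whatever the radius; the rest of the integrand is
\<open>(e\<^bsup>-z\<^esup> - 1)/z\<close>, which is bounded.
\<close>
lemma small_arc_bound_inverse:
  assumes "r > 0" "\<alpha> = 1"
  shows "norm (P (- \<i> * of_real r) - P (of_real r) + \<i> * of_real (pi / 2)) \<le> pi / 2 * r"
proof -
  let ?z = "\<lambda>\<theta>. of_real r * cis (- \<theta>)"
  let ?g = "\<lambda>\<theta>. P (?z \<theta>) + \<i> * of_real \<theta>"
  have "norm (?g (pi / 2) - ?g 0) \<le> r * (pi / 2) - r * 0"
  proof (rule differentiable_bound_general)
    show "continuous_on {0..pi/2} ?g"
      by (intro continuous_intros arc_continuous assms)
    fix \<theta> :: real assume \<theta>: "0 < \<theta>" "\<theta> < pi / 2"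
    have z: "?z \<theta> \<noteq> 0" using assms by simp
    have "((\<lambda>\<theta>. \<i> * complex_of_real \<theta>) has_vector_derivative \<i> * of_real 1) (at \<theta>)"
      by (intro has_vector_derivative_mult_right has_vector_derivative_of_real DERIV_ident)
    hence "(?g has_vector_derivative ?z \<theta> powr (- complex_of_real \<alpha>) * exp (- ?z \<theta>) * (- \<i> * ?z \<theta>) + \<i> * of_real 1) (at \<theta>)"
      by (intro has_vector_derivative_add arc_derivative) (use \<theta> assms in auto)
    moreover have "?z \<theta> powr (- complex_of_real \<alpha>) * exp (- ?z \<theta>) * (- \<i> * ?z \<theta>) + \<i> * of_real 1
        = - \<i> * (exp (- ?z \<theta>) - 1)"
      using z assms by (simp add: powr_minus powr_one field_simps)
    ultimately show "(?g has_vector_derivative - \<i> * (exp (- ?z \<theta>) - 1)) (at \<theta>)" by (simp only:)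
    show "((\<lambda>\<theta>. r * \<theta>) has_vector_derivative r) (at \<theta>)"
      unfolding has_real_derivative_iff_has_vector_derivative[symmetric]
      by (auto intro!: derivative_eq_intros)
    have "cos \<theta> \<ge> 0" using \<theta> by (intro cos_ge_zero) auto
    hence "norm (exp (- ?z \<theta>) - 1) \<le> norm (- ?z \<theta>)" 
      using assms by (intro norm_exp_minus_1_le) auto
    thus "norm (- \<i> * (exp (- ?z \<theta>) - 1)) \<le> r" using assms by (simp add: norm_mult)
  qed (auto intro!: continuous_intros)
  thus ?thesis by (simp add: mult.commute algebra_simps)
qed

lemma real_axis_integral:
  assumes "0 < x" "x \<le> y"
  shows "P (of_real y) - P (of_real x) = of_real (integral {x..y} (\<lambda>t. t powr (-\<alpha>) * exp (-t)))"
proof -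
  have "((\<lambda>t. complex_of_real (t powr (-\<alpha>) * exp (-t))) has_integral P (of_real y) - P (of_real x)) {x..y}"
  proof (rule fundamental_theorem_of_calculus[OF assms(2)])
    fix t assume "t \<in> {x..y}"
    hence t: "t > 0" using assms by auto
    hence "of_real t \<notin> (\<real>\<^sub>\<le>\<^sub>0 :: complex set)" by auto
    from has_vector_derivative_real_field[OF P[OF this]]
    have "((\<lambda>t. P (of_real t)) has_vector_derivative of_real t powr (- of_real \<alpha>) * exp (- of_real t)) (at t within {x..y})" .
    moreover have "complex_of_real t powr (- of_real \<alpha>) * exp (- of_real t) = of_real (t powr (-\<alpha>) * exp (-t))"
      using t powr_of_real[of t "-\<alpha>"] by (simp flip: exp_of_real)
    ultimately show "((\<lambda>t. P (of_real t)) has_vector_derivative of_real (t powr (-\<alpha>) * exp (-t))) (at t within {x..y})"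
      by simp
  qed
  moreover have "(\<lambda>t. t powr (-\<alpha>) * exp (-t)) integrable_on {x..y}"
    by (intro integrable_continuous_real continuous_intros) (use assms in auto)
  from has_integral_of_real[OF integrable_integral[OF this], where 'b = complex]
  have "((\<lambda>t. complex_of_real (t powr (-\<alpha>) * exp (-t))) has_integral
     of_real (integral {x..y} (\<lambda>t. t powr (-\<alpha>) * exp (-t)))) {x..y}" .
  ultimately show ?thesis by (rule has_integral_unique)
qed

text \<open>
The factor in front is \<open>i/\<omega>\<close>, from the speed \<open>-i\<omega>\<close> of the parametrisation \<open>-i\<omega>t\<close>, times the inverse of the constant
\<open>\<omega>\<^bsup>-\<alpha>\<^esup> e\<^bsup>i\<pi>\<alpha>/2\<^esup>\<close> in \<open>(-i\<omega>t)\<^bsup>-\<alpha>\<^esup>\<close>.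
\<close>
lemma imaginary_axis_integral:
  assumes "0 < x" "x \<le> y" "\<omega> > 0"
  shows "integral {x..y} (\<lambda>t. of_real (t powr (-\<alpha>)) * cis (\<omega> * t)) =
     \<i> * cis (- (pi / 2 * \<alpha>)) * of_real (\<omega> powr (\<alpha> - 1)) * (P (- \<i> * of_real (\<omega> * y)) - P (- \<i> * of_real (\<omega> * x)))"
proof -
  let ?k = "\<i> * cis (- (pi / 2 * \<alpha>)) * of_real (\<omega> powr (\<alpha> - 1))"
  have "((\<lambda>t. of_real (t powr (-\<alpha>)) * cis (\<omega> * t)) has_integral
     ?k * P (- \<i> * of_real (\<omega> * y)) - ?k * P (- \<i> * of_real (\<omega> * x))) {x..y}"
  proof (rule fundamental_theorem_of_calculus[OF assms(2)])
    fix t assume "t \<in> {x..y}"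
    hence t: "t > 0" using assms by auto
    have nz: "- \<i> * of_real (\<omega> * t) \<notin> \<real>\<^sub>\<le>\<^sub>0" using t assms by (auto simp: complex_nonpos_Reals_iff)
    have "((\<lambda>z. P (- \<i> * of_real \<omega> * z)) has_field_derivative
        (- \<i> * of_real (\<omega> * t)) powr (- of_real \<alpha>) * exp (- (- \<i> * of_real (\<omega> * t))) * (- \<i> * of_real \<omega>)) (at (of_real t))"
      using nz by (intro DERIV_chain'[where f = "\<lambda>z. - \<i> * of_real \<omega> * z" and g = P, OF _ P, THEN DERIV_cong])
         (auto intro!: derivative_eq_intros simp: mult_ac)
    from has_vector_derivative_real_field[OF this]
    have "((\<lambda>t. ?k * P (- \<i> * of_real \<omega> * of_real t)) has_vector_derivative
        ?k * ((- \<i> * of_real (\<omega> * t)) powr (- of_real \<alpha>) * exp (- (- \<i> * of_real (\<omega> * t))) * (- \<i> * of_real \<omega>))) (at t within {x..y})"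
      by (rule has_vector_derivative_mult_right)
    moreover have "(- \<i> * of_real (\<omega> * t)) powr (- of_real \<alpha>) = of_real ((\<omega> * t) powr (-\<alpha>)) * cis (pi / 2 * \<alpha>)"
      by (rule powr_minus_imaginary_axis) (use t assms in auto)
    moreover have "?k * (of_real ((\<omega> * t) powr (-\<alpha>)) * cis (pi / 2 * \<alpha>) * exp (- (- \<i> * of_real (\<omega> * t))) * (- \<i> * of_real \<omega>))
       = of_real (t powr (-\<alpha>)) * cis (\<omega> * t)"
    proof -
      have 1: "cis (- (pi / 2 * \<alpha>)) * cis (pi / 2 * \<alpha>) = 1" by (simp add: cis_mult)
      have 2: "\<omega> powr (\<alpha> - 1) * (\<omega> * t) powr (-\<alpha>) * \<omega> = t powr (-\<alpha>)"
        using assms t by (simp add: powr_mult powr_diff powr_minus field_simps)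
      have 3: "exp (- (- \<i> * of_real (\<omega> * t))) = cis (\<omega> * t)" by (simp add: cis_conv_exp)
      have "?k * (of_real ((\<omega> * t) powr (-\<alpha>)) * cis (pi / 2 * \<alpha>) * exp (- (- \<i> * of_real (\<omega> * t))) * (- \<i> * of_real \<omega>))
        = (\<i> * - \<i>) * (cis (- (pi / 2 * \<alpha>)) * cis (pi / 2 * \<alpha>)) * of_real (\<omega> powr (\<alpha> - 1) * (\<omega> * t) powr (-\<alpha>) * \<omega>) * cis (\<omega> * t)"
        unfolding 3 unfolding of_real_mult by (simp only: mult_ac)
      thus ?thesis unfolding 1 2 by simp
    qed
    ultimately show "((\<lambda>t. ?k * P (- \<i> * of_real (\<omega> * t))) has_vector_derivative of_real (t powr (-\<alpha>)) * cis (\<omega> * t)) (at t within {x..y})"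
      by (simp only: of_real_mult mult.assoc)
  qed
  thus ?thesis by (simp add: integral_unique right_diff_distrib)
qed

lemma tendsto_imaginary_at_top:
  assumes "\<alpha> > 0" and s: "((\<lambda>T. integral {1..T} (\<lambda>t. t powr (-\<alpha>) * exp (-t))) \<longlongrightarrow> s) at_top"
  shows "((\<lambda>r. P (- \<i> * of_real r)) \<longlongrightarrow> P 1 + of_real s) at_top"
proof -
  have "((\<lambda>r. P (- \<i> * of_real r) - P (of_real r)) \<longlongrightarrow> 0) at_top"
  proof (rule Lim_null_comparison)
    show "eventually (\<lambda>r. norm (P (- \<i> * of_real r) - P (of_real r)) \<le> pi / 2 * r powr (-\<alpha>)) at_top"
      using eventually_gt_at_top[of 0] by eventually_elim (rule large_arc_bound)
    show "((\<lambda>r. pi / 2 * r powr (-\<alpha>)) \<longlongrightarrow> 0) at_top" using assms(1) by real_asymp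
  qed
  moreover have "((\<lambda>r. P 1 + of_real (integral {1..r} (\<lambda>t. t powr (-\<alpha>) * exp (-t)))) \<longlongrightarrow> P 1 + of_real s) at_top"
    by (intro tendsto_intros s)
  ultimately have "((\<lambda>r. (P (- \<i> * of_real r) - P (of_real r)) + (P 1 + of_real (integral {1..r} (\<lambda>t. t powr (-\<alpha>) * exp (-t)))))
      \<longlongrightarrow> 0 + (P 1 + of_real s)) at_top" by (rule tendsto_add)
  moreover have "eventually (\<lambda>r. (P (- \<i> * of_real r) - P (of_real r)) + (P 1 + of_real (integral {1..r} (\<lambda>t. t powr (-\<alpha>) * exp (-t))))
     = P (- \<i> * of_real r)) at_top"
    using eventually_ge_at_top[of 1]
  proof eventually_elim
    case (elim r)
    show ?case using real_axis_integral[OF zero_less_one elim] by (simp add: algebra_simps)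
  qed
  ultimately have "((\<lambda>r. P (- \<i> * of_real r)) \<longlongrightarrow> 0 + (P 1 + of_real s)) at_top"
    by (rule Lim_transform_eventually)
  thus ?thesis by simp
qed

end

text \<open>
The integrand is holomorphic on the slit plane, which is open and starlike.
\<close>
lemma gamma_primitive_exists: obtains P where "gamma_primitive \<alpha> P"
proof -
  let ?S = "- (complex_of_real ` {..0})"
  have S: "?S = - \<real>\<^sub>\<le>\<^sub>0" by (auto simp: nonpos_Reals_def image_def)
  have "\<exists>g. \<forall>z\<in>?S. (g has_field_derivative z powr (- complex_of_real \<alpha>) * exp (- z)) (at z)"
  proof (rule holomorphic_starlike_primitive[of _ _ "{}"])
    have h: "(\<lambda>z. z powr (- complex_of_real \<alpha>) * exp (- z)) holomorphic_on ?S"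
      unfolding S by (intro holomorphic_intros) auto
    thus "continuous_on ?S (\<lambda>z. z powr (- complex_of_real \<alpha>) * exp (- z))"
      by (rule holomorphic_on_imp_continuous_on)
    show op: "open ?S" unfolding S by (simp add: open_Compl)
    show "starlike ?S" by (rule starlike_slotted_complex_plane_left)
    fix z assume "z \<in> ?S - {}"
    thus "(\<lambda>z. z powr (- complex_of_real \<alpha>) * exp (- z)) field_differentiable at z"
      using h op by (auto simp: holomorphic_on_open field_differentiable_def)
  qed auto
  then obtain g where "\<And>z. z \<in> ?S \<Longrightarrow> (g has_field_derivative z powr (- complex_of_real \<alpha>) * exp (- z)) (at z)"
    by blast
  hence "gamma_primitive \<alpha> g" unfolding gamma_primitive_def S by simp
  thus ?thesis using that by blast
qed

section \<open>Oscillatory integrals of pure powers\<close>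

text \<open>
The value of the integral of \<open>t\<^sup>c e\<^bsup>i\<omega>t\<^esup>\<close> over \<open>(0,\<infinity>)\<close> in the sense of Abel summation. For \<open>-1 < c < 0\<close> the
integral converges; for \<open>c \<ge> 0\<close> it diverges and this is its regularised value.
\<close>
definition abel_power_integral :: "real \<Rightarrow> real \<Rightarrow> complex" where
  "abel_power_integral \<omega> c = of_real (Gamma (c + 1) / \<omega> powr (c + 1)) * cis (pi / 2 * (c + 1))"

lemma oscillatory_power_integrable:
  "c > -1 \<Longrightarrow> (\<lambda>t. of_real (t powr c) * cis (\<omega> * t)) integrable_on {0..1}"
  by (rule integrable_singular_at_0[of "-c" _ 1]) (auto intro!: continuous_intros)

text \<open>
Along the two axes the primitive differs by \<open>O(r\<^bsup>1-\<alpha>\<^esup>)\<close> for small \<open>r\<close> and by \<open>O(r\<^bsup>-\<alpha>\<^esup>)\<close> for large \<open>r\<close>, so both limits on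
the imaginary axis are those on the real axis, where they are given by the Gamma integral.
\<close>
lemma oscillatory_power_integral:
  assumes "0 < \<alpha>" "\<alpha> < 1" "\<omega> > 0"
  obtains C J where
    "((\<lambda>x. integral {x..1} (\<lambda>t. of_real (t powr (-\<alpha>)) * cis (\<omega> * t))) \<longlongrightarrow> C) (at_right 0)"
    "((\<lambda>T. integral {1..T} (\<lambda>t. of_real (t powr (-\<alpha>)) * cis (\<omega> * t))) \<longlongrightarrow> J) at_top"
    "C + J = abel_power_integral \<omega> (-\<alpha>)"
proof -
  obtain P where "gamma_primitive \<alpha> P" by (rule gamma_primitive_exists)
  then interpret gamma_primitive \<alpha> P .
  obtain r s where rs: "((\<lambda>x. integral {x..1} (\<lambda>t. t powr (-\<alpha>) * exp (-t))) \<longlongrightarrow> r) (at_right 0)"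
    "((\<lambda>T. integral {1..T} (\<lambda>t. t powr (-\<alpha>) * exp (-t))) \<longlongrightarrow> s) at_top" "r + s = Gamma (1 - \<alpha>)"
    by (rule Gamma_integral_split_at_1[OF assms(2)])
  have "((\<lambda>r. P (- \<i> * of_real r) - P (of_real r)) \<longlongrightarrow> 0) (at_right 0)"
  proof (rule Lim_null_comparison)
    show "eventually (\<lambda>r. norm (P (- \<i> * of_real r) - P (of_real r)) \<le> pi / 2 * r powr (1 - \<alpha>)) (at_right 0)"
      using eventually_at_right_less[of 0] by eventually_elim (rule small_arc_bound)
    show "((\<lambda>r. pi / 2 * r powr (1 - \<alpha>)) \<longlongrightarrow> 0) (at_right 0)" using assms(2) by real_asymp
  qed
  moreover have "((\<lambda>x. P 1 - of_real (integral {x..1} (\<lambda>t. t powr (-\<alpha>) * exp (-t)))) \<longlongrightarrow> P 1 - of_real r) (at_right 0)"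
    by (intro tendsto_intros rs)
  ultimately have "((\<lambda>x. (P (- \<i> * of_real x) - P (of_real x)) + (P 1 - of_real (integral {x..1} (\<lambda>t. t powr (-\<alpha>) * exp (-t)))))
      \<longlongrightarrow> 0 + (P 1 - of_real r)) (at_right 0)" by (rule tendsto_add)
  moreover have "eventually (\<lambda>x. (P (- \<i> * of_real x) - P (of_real x)) + (P 1 - of_real (integral {x..1} (\<lambda>t. t powr (-\<alpha>) * exp (-t))))
     = P (- \<i> * of_real x)) (at_right 0)"
    using eventually_at_right_real[OF zero_less_one]
  proof eventually_elim
    case (elim x)
    have "P 1 - P (of_real x) = of_real (integral {x..1} (\<lambda>t. t powr (-\<alpha>) * exp (-t)))"
      using real_axis_integral[of x 1] elim by simp
    hence e: "complex_of_real (integral {x..1} (\<lambda>t. t powr (-\<alpha>) * exp (-t))) = P 1 - P (of_real x)" by (rule sym)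
    show ?case unfolding e by simp
  qed
  ultimately have "((\<lambda>x. P (- \<i> * of_real x)) \<longlongrightarrow> 0 + (P 1 - of_real r)) (at_right 0)"
    by (rule Lim_transform_eventually)
  hence P0: "((\<lambda>x. P (- \<i> * of_real x)) \<longlongrightarrow> P 1 - of_real r) (at_right 0)" by simp
  let ?k = "\<i> * cis (- (pi / 2 * \<alpha>)) * of_real (\<omega> powr (\<alpha> - 1))"
  have "filterlim (\<lambda>x. \<omega> * x) (at_right 0) (at_right 0)" using assms(3) by real_asymp
  hence "((\<lambda>x. P (- \<i> * of_real (\<omega> * x))) \<longlongrightarrow> P 1 - of_real r) (at_right 0)"
    by (rule filterlim_compose[OF P0])
  hence "((\<lambda>x. ?k * (P (- \<i> * of_real (\<omega> * 1)) - P (- \<i> * of_real (\<omega> * x))))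
      \<longlongrightarrow> ?k * (P (- \<i> * of_real (\<omega> * 1)) - (P 1 - of_real r))) (at_right 0)"
    by (intro tendsto_intros)
  moreover have "eventually (\<lambda>x. ?k * (P (- \<i> * of_real (\<omega> * 1)) - P (- \<i> * of_real (\<omega> * x)))
     = integral {x..1} (\<lambda>t. of_real (t powr (-\<alpha>)) * cis (\<omega> * t))) (at_right 0)"
    using eventually_at_right_real[OF zero_less_one]
    by eventually_elim (rule imaginary_axis_integral[symmetric], use assms in auto)
  ultimately have 1: "((\<lambda>x. integral {x..1} (\<lambda>t. of_real (t powr (-\<alpha>)) * cis (\<omega> * t)))
      \<longlongrightarrow> ?k * (P (- \<i> * of_real (\<omega> * 1)) - (P 1 - of_real r))) (at_right 0)"
    by (rule Lim_transform_eventually)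
  have "filterlim (\<lambda>x. \<omega> * x) at_top at_top" using assms(3) by real_asymp
  hence "((\<lambda>x. P (- \<i> * of_real (\<omega> * x))) \<longlongrightarrow> P 1 + of_real s) at_top"
    by (rule filterlim_compose[OF tendsto_imaginary_at_top[OF assms(1) rs(2)]])
  hence "((\<lambda>x. ?k * (P (- \<i> * of_real (\<omega> * x)) - P (- \<i> * of_real (\<omega> * 1))))
      \<longlongrightarrow> ?k * (P 1 + of_real s - P (- \<i> * of_real (\<omega> * 1)))) at_top"
    by (intro tendsto_intros)
  moreover have "eventually (\<lambda>x. ?k * (P (- \<i> * of_real (\<omega> * x)) - P (- \<i> * of_real (\<omega> * 1)))
     = integral {1..x} (\<lambda>t. of_real (t powr (-\<alpha>)) * cis (\<omega> * t))) at_top"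
    using eventually_ge_at_top[of 1]
    by eventually_elim (rule imaginary_axis_integral[symmetric], use assms in auto)
  ultimately have 2: "((\<lambda>x. integral {1..x} (\<lambda>t. of_real (t powr (-\<alpha>)) * cis (\<omega> * t)))
      \<longlongrightarrow> ?k * (P 1 + of_real s - P (- \<i> * of_real (\<omega> * 1)))) at_top"
    by (rule Lim_transform_eventually)
  have "?k * (P (- \<i> * of_real (\<omega> * 1)) - (P 1 - of_real r)) + ?k * (P 1 + of_real s - P (- \<i> * of_real (\<omega> * 1)))
      = ?k * of_real (r + s)"
    by (simp add: algebra_simps)
  also have "\<dots> = abel_power_integral \<omega> (-\<alpha>)"
  proof -
    have "\<i> * cis (- (pi / 2 * \<alpha>)) = cis (pi / 2) * cis (- (pi / 2 * \<alpha>))" by simp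
    also have "\<dots> = cis (pi / 2 + - (pi / 2 * \<alpha>))" by (rule cis_mult)
    also have "pi / 2 + - (pi / 2 * \<alpha>) = pi / 2 * (-\<alpha> + 1)" by (simp add: algebra_simps)
    finally have 1: "\<i> * cis (- (pi / 2 * \<alpha>)) = cis (pi / 2 * (-\<alpha> + 1))" .
    have 2: "\<omega> powr (\<alpha> - 1) = 1 / \<omega> powr (-\<alpha> + 1)"
      using powr_minus_divide[of \<omega> "-\<alpha> + 1"] by simp
    show ?thesis unfolding 1 2 rs(3) abel_power_integral_def by simp
  qed
  finally show ?thesis using that[OF 1 2] by simp
qed

text \<open>
On the real axis the finite part is \<open>-\<gamma>\<close>. The small arc adds \<open>i\<pi>/2\<close>, and since the lower limit is \<open>\<omega>x\<close> after
scaling, the logarithm of \<open>x\<close> that is split off leaves \<open>-log \<omega>\<close> behind.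
\<close>
lemma oscillatory_inverse_integral:
  assumes "\<omega> > 0"
  obtains C J where
    "((\<lambda>x. integral {x..1} (\<lambda>t. of_real (t powr (-1)) * cis (\<omega> * t)) + of_real (ln x)) \<longlongrightarrow> C) (at_right 0)"
    "((\<lambda>T. integral {1..T} (\<lambda>t. of_real (t powr (-1)) * cis (\<omega> * t))) \<longlongrightarrow> J) at_top"
    "C + J = \<i> * of_real (pi / 2) - euler_mascheroni - of_real (ln \<omega>)"
proof -
  obtain P where "gamma_primitive 1 P" by (rule gamma_primitive_exists)
  then interpret gamma_primitive 1 P .
  obtain r s :: real where rs: "((\<lambda>x. integral {x..1} (\<lambda>t. t powr (-1) * exp (-t)) + ln x) \<longlongrightarrow> r) (at_right 0)"
    "((\<lambda>T. integral {1..T} (\<lambda>t. t powr (-1) * exp (-t))) \<longlongrightarrow> s) at_top" "r + s = - euler_mascheroni"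
    by (rule exponential_integral_split_at_1)
  have "((\<lambda>r. P (- \<i> * of_real r) - P (of_real r) + \<i> * of_real (pi / 2)) \<longlongrightarrow> 0) (at_right 0)"
  proof (rule Lim_null_comparison)
    show "eventually (\<lambda>r. norm (P (- \<i> * of_real r) - P (of_real r) + \<i> * of_real (pi / 2)) \<le> pi / 2 * r) (at_right 0)"
      using eventually_at_right_less[of 0] by eventually_elim (rule small_arc_bound_inverse, auto)
    show "((\<lambda>r. pi / 2 * r) \<longlongrightarrow> 0) (at_right 0)" by real_asymp
  qed
  moreover have "((\<lambda>x. P 1 - of_real (integral {x..1} (\<lambda>t. t powr (-1) * exp (-t)) + ln x) - \<i> * of_real (pi / 2))
      \<longlongrightarrow> P 1 - of_real r - \<i> * of_real (pi / 2)) (at_right 0)"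
    by (intro tendsto_intros rs)
  ultimately have "((\<lambda>x. (P (- \<i> * of_real x) - P (of_real x) + \<i> * of_real (pi / 2))
        + (P 1 - of_real (integral {x..1} (\<lambda>t. t powr (-1) * exp (-t)) + ln x) - \<i> * of_real (pi / 2)))
      \<longlongrightarrow> 0 + (P 1 - of_real r - \<i> * of_real (pi / 2))) (at_right 0)" by (rule tendsto_add)
  moreover have "eventually (\<lambda>x. (P (- \<i> * of_real x) - P (of_real x) + \<i> * of_real (pi / 2))
        + (P 1 - of_real (integral {x..1} (\<lambda>t. t powr (-1) * exp (-t)) + ln x) - \<i> * of_real (pi / 2))
     = P (- \<i> * of_real x) - of_real (ln x)) (at_right 0)"
    using eventually_at_right_real[OF zero_less_one]
  proof eventually_elim
    case (elim x)
    have "P 1 - P (of_real x) = of_real (integral {x..1} (\<lambda>t. t powr (-1) * exp (-t)))"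
      using real_axis_integral[of x 1] elim by simp
    hence e: "complex_of_real (integral {x..1} (\<lambda>t. t powr (-1) * exp (-t))) = P 1 - P (of_real x)" by (rule sym)
    show ?case unfolding of_real_add e by simp
  qed
  ultimately have "((\<lambda>x. P (- \<i> * of_real x) - of_real (ln x)) \<longlongrightarrow> 0 + (P 1 - of_real r - \<i> * of_real (pi / 2))) (at_right 0)"
    by (rule Lim_transform_eventually)
  hence P0: "((\<lambda>x. P (- \<i> * of_real x) - of_real (ln x)) \<longlongrightarrow> P 1 - of_real r - \<i> * of_real (pi / 2)) (at_right 0)" by simp
  have k: "\<i> * cis (- (pi / 2 * 1)) * of_real (\<omega> powr (1 - 1)) = 1"
    using assms by (simp add: cis_minus_pi_half)
  have im: "integral {x..y} (\<lambda>t. of_real (t powr (-1)) * cis (\<omega> * t)) = P (- \<i> * of_real (\<omega> * y)) - P (- \<i> * of_real (\<omega> * x))"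
    if "0 < x" "x \<le> y" for x y
    using imaginary_axis_integral[OF that assms] unfolding k by simp
  have "filterlim (\<lambda>x. \<omega> * x) (at_right 0) (at_right 0)" using assms by real_asymp
  hence "((\<lambda>x. P (- \<i> * of_real (\<omega> * x)) - of_real (ln (\<omega> * x))) \<longlongrightarrow> P 1 - of_real r - \<i> * of_real (pi / 2)) (at_right 0)"
    by (rule filterlim_compose[OF P0])
  hence "((\<lambda>x. P (- \<i> * of_real (\<omega> * 1)) - (P (- \<i> * of_real (\<omega> * x)) - of_real (ln (\<omega> * x))) - of_real (ln \<omega>))
      \<longlongrightarrow> P (- \<i> * of_real (\<omega> * 1)) - (P 1 - of_real r - \<i> * of_real (pi / 2)) - of_real (ln \<omega>)) (at_right 0)"
    by (intro tendsto_diff[OF tendsto_diff[OF tendsto_const] tendsto_const])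
  moreover have "eventually (\<lambda>x. P (- \<i> * of_real (\<omega> * 1)) - (P (- \<i> * of_real (\<omega> * x)) - of_real (ln (\<omega> * x))) - of_real (ln \<omega>)
     = integral {x..1} (\<lambda>t. of_real (t powr (-1)) * cis (\<omega> * t)) + of_real (ln x)) (at_right 0)"
    using eventually_at_right_real[OF zero_less_one]
  proof eventually_elim
    case (elim x)
    have l: "ln (\<omega> * x) = ln \<omega> + ln x" using elim assms by (simp add: ln_mult)
    show ?case using elim im[of x 1] unfolding l by simp
  qed
  ultimately have 1: "((\<lambda>x. integral {x..1} (\<lambda>t. of_real (t powr (-1)) * cis (\<omega> * t)) + of_real (ln x))
      \<longlongrightarrow> P (- \<i> * of_real (\<omega> * 1)) - (P 1 - of_real r - \<i> * of_real (pi / 2)) - of_real (ln \<omega>)) (at_right 0)"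
    by (rule Lim_transform_eventually)
  have "filterlim (\<lambda>x. \<omega> * x) at_top at_top" using assms by real_asymp
  hence "((\<lambda>x. P (- \<i> * of_real (\<omega> * x))) \<longlongrightarrow> P 1 + of_real s) at_top"
    by (rule filterlim_compose[OF tendsto_imaginary_at_top[OF zero_less_one rs(2)]])
  hence "((\<lambda>x. P (- \<i> * of_real (\<omega> * x)) - P (- \<i> * of_real (\<omega> * 1)))
      \<longlongrightarrow> P 1 + of_real s - P (- \<i> * of_real (\<omega> * 1))) at_top"
    by (intro tendsto_intros)
  moreover have "eventually (\<lambda>x. P (- \<i> * of_real (\<omega> * x)) - P (- \<i> * of_real (\<omega> * 1))
     = integral {1..x} (\<lambda>t. of_real (t powr (-1)) * cis (\<omega> * t))) at_top"
    using eventually_ge_at_top[of 1] by eventually_elim (rule im[symmetric], auto)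
  ultimately have 2: "((\<lambda>x. integral {1..x} (\<lambda>t. of_real (t powr (-1)) * cis (\<omega> * t)))
      \<longlongrightarrow> P 1 + of_real s - P (- \<i> * of_real (\<omega> * 1))) at_top"
    by (rule Lim_transform_eventually)
  have "complex_of_real r + of_real s = - euler_mascheroni"
    using rs(3) by (metis of_real_add of_real_euler_mascheroni of_real_minus)
  hence rs': "of_real s = - euler_mascheroni - complex_of_real r" by (simp add: eq_diff_eq add.commute)
  have "(P (- \<i> * of_real (\<omega> * 1)) - (P 1 - of_real r - \<i> * of_real (pi / 2)) - of_real (ln \<omega>))
      + (P 1 + of_real s - P (- \<i> * of_real (\<omega> * 1))) = \<i> * of_real (pi / 2) - euler_mascheroni - of_real (ln \<omega>)"
    unfolding rs' by simp
  thus ?thesis using that[OF 1 2] by simp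
qed

lemma oscillatory_power_integral_0_1_rec:
  assumes "c > -1" "\<omega> > 0"
  shows "integral {0..1} (\<lambda>t. of_real (t powr (c + 1)) * cis (\<omega> * t)) =
     - (\<i> / of_real \<omega>) * cis \<omega>
     + \<i> / of_real \<omega> * of_real (c + 1) * integral {0..1} (\<lambda>t. of_real (t powr c) * cis (\<omega> * t))"
proof -
  let ?q = "\<i> / complex_of_real \<omega>"
  have "((\<lambda>t. of_real (t powr (c + 1)) * cis (\<omega> * t) - ?q * of_real (c + 1) * (of_real (t powr c) * cis (\<omega> * t)))
     has_integral (- ?q * (of_real (1 powr (c + 1)) * cis (\<omega> * 1))) - (- ?q * (of_real (0 powr (c + 1)) * cis (\<omega> * 0)))) {0..1}"
  proof (rule fundamental_theorem_of_calculus_interior)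
    have "continuous_on {0..1} (\<lambda>t. t powr (c + 1))"
      by (rule continuous_on_powr') (use assms in \<open>auto intro: continuous_intros\<close>)
    hence "continuous_on {0..1} (\<lambda>t. complex_of_real (t powr (c + 1)))"
      by (rule continuous_on_of_real)
    thus "continuous_on {0..1} (\<lambda>t. - ?q * (of_real (t powr (c + 1)) * cis (\<omega> * t)))"
      by (intro continuous_on_mult continuous_on_const continuous_on_cis_mult)
    fix t :: real assume t: "t \<in> {0<..<1}"
    have "((\<lambda>t. t powr (c + 1)) has_real_derivative (c + 1) * t powr c) (at t)"
      using has_real_derivative_powr[of t "c + 1"] t by simp
    hence "((\<lambda>t. complex_of_real (t powr (c + 1))) has_vector_derivative of_real ((c + 1) * t powr c)) (at t)"
      by (rule has_vector_derivative_of_real)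
    from has_vector_derivative_mult[OF this has_vector_derivative_cis[of \<omega>]]
    have "((\<lambda>t. - ?q * (of_real (t powr (c + 1)) * cis (\<omega> * t))) has_vector_derivative
      - ?q * (of_real (t powr (c + 1)) * (\<i> * of_real \<omega> * cis (\<omega> * t)) + of_real ((c + 1) * t powr c) * cis (\<omega> * t))) (at t)"
      by (rule has_vector_derivative_mult_right)
    moreover have q: "?q * (\<i> * of_real \<omega>) = -1" using assms by simp
    have "- ?q * (of_real (t powr (c + 1)) * (\<i> * of_real \<omega> * cis (\<omega> * t)) + of_real ((c + 1) * t powr c) * cis (\<omega> * t))
      = of_real (t powr (c + 1)) * cis (\<omega> * t) - ?q * of_real (c + 1) * (of_real (t powr c) * cis (\<omega> * t))"
     
    proof -
      have alg: "- p * (A * (w * e) + C * e) = - (p * w) * A * e - p * (C * e)" for p w A C e :: complex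
        by (simp add: algebra_simps)
      show ?thesis unfolding alg q by (simp add: mult_ac)
    qed
    ultimately show "((\<lambda>t. - ?q * (of_real (t powr (c + 1)) * cis (\<omega> * t))) has_vector_derivative
      of_real (t powr (c + 1)) * cis (\<omega> * t) - ?q * of_real (c + 1) * (of_real (t powr c) * cis (\<omega> * t))) (at t)"
      by (simp only:)
  qed simp
  hence "integral {0..1} (\<lambda>t. of_real (t powr (c + 1)) * cis (\<omega> * t) - ?q * of_real (c + 1) * (of_real (t powr c) * cis (\<omega> * t)))
     = - ?q * cis \<omega>"
    using assms by (simp add: integral_unique)
  moreover have "integral {0..1} (\<lambda>t. of_real (t powr (c + 1)) * cis (\<omega> * t) - ?q * of_real (c + 1) * (of_real (t powr c) * cis (\<omega> * t)))
     = integral {0..1} (\<lambda>t. of_real (t powr (c + 1)) * cis (\<omega> * t)) - ?q * of_real (c + 1) * integral {0..1} (\<lambda>t. of_real (t powr c) * cis (\<omega> * t))"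
    using assms by (subst integral_diff) (auto intro!: oscillatory_power_integrable integrable_on_mult_right)
  ultimately show ?thesis by (simp add: diff_eq_eq)
qed

lemma boundary_sum_powr_Suc:
  "boundary_sum \<omega> (Suc m) (powr_deriv (c + 1)) 1 =
     - (\<i> / of_real \<omega>) * cis \<omega> + \<i> / of_real \<omega> * of_real (c + 1) * boundary_sum \<omega> m (powr_deriv c) 1"
  unfolding boundary_sum_def
  by (subst sum.lessThan_Suc_shift)
     (simp add: powr_deriv_Suc sum_distrib_left mult_ac del: sum.lessThan_Suc)

lemma abel_power_integral_Suc:
  assumes "c > -1" "\<omega> > 0"
  shows "abel_power_integral \<omega> (c + 1) = \<i> / of_real \<omega> * of_real (c + 1) * abel_power_integral \<omega> c"
proof -
  have "c + 1 \<notin> \<int>\<^sub>\<le>\<^sub>0" using assms(1) nonpos_Ints_nonpos[of "c + 1"] by auto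
  hence 1: "Gamma (c + 1 + 1) = (c + 1) * Gamma (c + 1)" by (rule Gamma_plus1)
  have 2: "\<omega> powr (c + 1 + 1) = \<omega> powr (c + 1) * \<omega>" using assms by (simp add: powr_add power2_eq_square)
  have "cis (pi / 2 * (c + 1 + 1)) = cis (pi / 2 * (c + 1) + pi / 2)"
    by (rule arg_cong[where f = cis]) (simp add: algebra_simps add_divide_distrib)
  also have "\<dots> = cis (pi / 2 * (c + 1)) * \<i>" by (simp only: cis_mult[symmetric] cis_pi_half)
  finally have 3: "cis (pi / 2 * (c + 1 + 1)) = cis (pi / 2 * (c + 1)) * \<i>" .
  show ?thesis unfolding abel_power_integral_def 1 2 3 by (simp add: mult_ac)
qed

text \<open>
The number on the right is what the \<open>m\<close>-fold integrated tail over \<open>(1,\<infinity>)\<close> must be for the Abel value to be the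
total of the integral over \<open>(0,1)\<close>, the boundary terms at \<open>1\<close> and that tail. For \<open>k = 0\<close> the integral converges
(or, when \<open>\<alpha> = 0\<close>, the tail vanishes identically and everything is elementary). Replacing \<open>c\<close>
by \<open>c + 1\<close> and \<open>m\<close> by \<open>m + 1\<close> multiplies every part by the same factor \<open>(c+1) i/\<omega>\<close>, up to the same boundary
term at \<open>1\<close>, which cancels.
\<close>
lemma power_tail_limit:
  assumes \<alpha>: "0 \<le> \<alpha>" "\<alpha> < 1" and \<omega>: "\<omega> > 0" and "k < m"
  shows "((\<lambda>T. (\<i> / of_real \<omega>) ^ m * integral {1..T} (\<lambda>t. of_real (powr_deriv (real k - \<alpha>) m t) * cis (\<omega> * t)))
     \<longlongrightarrow> abel_power_integral \<omega> (real k - \<alpha>)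
        - integral {0..1} (\<lambda>t. of_real (t powr (real k - \<alpha>)) * cis (\<omega> * t))
        + boundary_sum \<omega> m (powr_deriv (real k - \<alpha>)) 1) at_top"
  using assms(4)
proof (induction k arbitrary: m)
  case 0
  let ?q = "\<i> / complex_of_real \<omega>"
  show ?case
  proof (cases "\<alpha> = 0")
    case True
    \<comment> \<open>The power is the constant 1, so the derivatives of positive order vanish.\<close>
    have z: "powr_deriv 0 s t = 0" if "s > 0" for s t using that by (auto simp: powr_deriv_def)
    have m: "m > 0" using 0 by simp
    have "boundary_sum \<omega> m (powr_deriv 0) 1 = - (\<Sum>s<m. if s = 0 then ?q * cis \<omega> else 0)"
      unfolding boundary_sum_def
      by (intro arg_cong[where f = uminus] sum.cong) (auto simp: z)
    hence b: "boundary_sum \<omega> m (powr_deriv 0) 1 = - ?q * cis \<omega>" using m by simp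
    have "((\<lambda>t. - ?q * (\<i> * of_real \<omega> * cis (\<omega> * t))) has_integral - ?q * cis (\<omega> * 1) - - ?q * cis (\<omega> * 0)) {0..1}"
      by (intro fundamental_theorem_of_calculus has_vector_derivative_mult_right has_vector_derivative_cis) auto
    hence "integral {0..1} (\<lambda>t. cis (\<omega> * t)) = ?q - ?q * cis \<omega>"
      using \<omega> by (simp add: integral_unique)
    moreover have "integral {0..1} (\<lambda>t. of_real (t powr 0) * cis (\<omega> * t)) = integral {0..1} (\<lambda>t. cis (\<omega> * t))"
      by (rule integral_spike[of "{0}"]) auto
    ultimately have i: "integral {0..1} (\<lambda>t. of_real (t powr 0) * cis (\<omega> * t)) = ?q - ?q * cis \<omega>" by simp
    have g: "abel_power_integral \<omega> 0 = ?q" using \<omega> by (simp add: abel_power_integral_def)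
    have "((\<lambda>T::real. 0 :: complex) \<longlongrightarrow> ?q - (?q - ?q * cis \<omega>) + - ?q * cis \<omega>) at_top" by simp
    thus ?thesis using True z[OF m] by (simp only: i g b of_nat_0 diff_0_right of_real_0 mult_zero_left mult_zero_right integral_0)
  next
    case False
    hence "0 < \<alpha>" using \<alpha> by simp
    then obtain C J where CJ:
      "((\<lambda>x. integral {x..1} (\<lambda>t. of_real (t powr (-\<alpha>)) * cis (\<omega> * t))) \<longlongrightarrow> C) (at_right 0)"
      "((\<lambda>T. integral {1..T} (\<lambda>t. of_real (t powr (-\<alpha>)) * cis (\<omega> * t))) \<longlongrightarrow> J) at_top"
      "C + J = abel_power_integral \<omega> (-\<alpha>)"
      by (rule oscillatory_power_integral[OF _ \<alpha>(2) \<omega>])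
    have "C = integral {0..1} (\<lambda>t. of_real (t powr (-\<alpha>)) * cis (\<omega> * t))"
      by (rule tendsto_unique[OF _ CJ(1) tendsto_integral_at_right_0[OF oscillatory_power_integrable]])
         (use \<alpha> in auto)
    hence J: "J = abel_power_integral \<omega> (-\<alpha>) - integral {0..1} (\<lambda>t. of_real (t powr (-\<alpha>)) * cis (\<omega> * t))"
      using CJ(3) by (simp add: algebra_simps)
    have b: "(boundary_sum \<omega> m (powr_deriv (-\<alpha>)) \<longlongrightarrow> 0) at_top"
    proof (rule boundary_sum_tendsto_0)
      fix s
      have "((\<lambda>T. T powr (-\<alpha> - real s)) \<longlongrightarrow> 0) at_top"
        using \<open>0 < \<alpha>\<close> by (intro tendsto_neg_powr filterlim_ident) auto
      from tendsto_mult[OF tendsto_const this]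
      show "(powr_deriv (-\<alpha>) s \<longlongrightarrow> 0) at_top"
        unfolding powr_deriv_def[abs_def] by simp
    qed
    have "((\<lambda>T. integral {1..T} (\<lambda>t. of_real (t powr (-\<alpha>)) * cis (\<omega> * t)) - boundary_sum \<omega> m (powr_deriv (-\<alpha>)) T
        + boundary_sum \<omega> m (powr_deriv (-\<alpha>)) 1) \<longlongrightarrow> J - 0 + boundary_sum \<omega> m (powr_deriv (-\<alpha>)) 1) at_top"
      by (intro tendsto_intros CJ b)
    moreover have "eventually (\<lambda>T. integral {1..T} (\<lambda>t. of_real (t powr (-\<alpha>)) * cis (\<omega> * t)) - boundary_sum \<omega> m (powr_deriv (-\<alpha>)) T
        + boundary_sum \<omega> m (powr_deriv (-\<alpha>)) 1 = ?q ^ m * integral {1..T} (\<lambda>t. of_real (powr_deriv (-\<alpha>) m t) * cis (\<omega> * t))) at_top"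
      using eventually_ge_at_top[of 1]
    proof eventually_elim
      case (elim T)
      show ?case using integral_by_parts_chain[OF deriv_chain_powr[of m "-\<alpha>"] _ zero_less_one elim, of \<omega>] \<omega> by simp
    qed
    ultimately have "((\<lambda>T. ?q ^ m * integral {1..T} (\<lambda>t. of_real (powr_deriv (-\<alpha>) m t) * cis (\<omega> * t)))
        \<longlongrightarrow> J - 0 + boundary_sum \<omega> m (powr_deriv (-\<alpha>)) 1) at_top"
      by (rule Lim_transform_eventually)
    thus ?thesis by (simp add: J)
  qed
next
  case (Suc k)
  then obtain n where m: "m = Suc n" "k < n" by (cases m) auto
  let ?q = "\<i> / complex_of_real \<omega>"
  define c where "c = real k - \<alpha>"
  have c: "c > -1" "real (Suc k) - \<alpha> = c + 1" using \<alpha> by (auto simp: c_def)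
  have "((\<lambda>T. ?q * of_real (c + 1) * (?q ^ n * integral {1..T} (\<lambda>t. of_real (powr_deriv c n t) * cis (\<omega> * t))))
     \<longlongrightarrow> ?q * of_real (c + 1) * (abel_power_integral \<omega> c
        - integral {0..1} (\<lambda>t. of_real (t powr c) * cis (\<omega> * t)) + boundary_sum \<omega> n (powr_deriv c) 1)) at_top"
    unfolding c_def by (intro tendsto_mult[OF tendsto_const] Suc.IH m(2))
  moreover have "?q * of_real (c + 1) * (?q ^ n * integral {1..T} (\<lambda>t. of_real (powr_deriv c n t) * cis (\<omega> * t)))
      = ?q ^ Suc n * integral {1..T} (\<lambda>t. of_real (powr_deriv (c + 1) (Suc n) t) * cis (\<omega> * t))" for T
  proof -
    have "integral {1..T} (\<lambda>t. of_real (powr_deriv (c + 1) (Suc n) t) * cis (\<omega> * t))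
        = of_real (c + 1) * integral {1..T} (\<lambda>t. of_real (powr_deriv c n t) * cis (\<omega> * t))"
      unfolding powr_deriv_Suc of_real_mult mult.assoc by (rule integral_mult_right)
    thus ?thesis by simp
  qed
  moreover have "?q * of_real (c + 1) * (abel_power_integral \<omega> c
        - integral {0..1} (\<lambda>t. of_real (t powr c) * cis (\<omega> * t)) + boundary_sum \<omega> n (powr_deriv c) 1)
      = abel_power_integral \<omega> (c + 1)
        - integral {0..1} (\<lambda>t. of_real (t powr (c + 1)) * cis (\<omega> * t)) + boundary_sum \<omega> (Suc n) (powr_deriv (c + 1)) 1"
    unfolding boundary_sum_powr_Suc oscillatory_power_integral_0_1_rec[OF c(1) \<omega>] abel_power_integral_Suc[OF c(1) \<omega>]
    by (simp only: algebra_simps)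
  ultimately show ?case unfolding m(1) c(2) by (simp only:)
qed

text \<open>
The tail is a limit of integrals of \<open>t\<^bsup>k-\<alpha>-m\<^esup> e\<^bsup>i\<omega>t\<^esup>\<close> with a negative exponent, so it inherits their
bound \<open>2/\<omega>\<close>.
\<close>
lemma norm_power_tail_le:
  assumes \<alpha>: "0 \<le> \<alpha>" "\<alpha> < 1" and \<omega>: "\<omega> > 0" and "k < m"
  defines "X \<equiv> abel_power_integral \<omega> (real k - \<alpha>)
        - integral {0..1} (\<lambda>t. of_real (t powr (real k - \<alpha>)) * cis (\<omega> * t))
        + boundary_sum \<omega> m (powr_deriv (real k - \<alpha>)) 1"
  shows "norm X \<le> \<omega> powr (- real m) * (\<bar>\<Prod>i<m. real k - \<alpha> - real i\<bar> * (2 / \<omega>))"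
proof -
  let ?q = "\<i> / complex_of_real \<omega>"
  let ?p = "\<Prod>i<m. real k - \<alpha> - real i"
  have q: "norm (?q ^ m) = \<omega> powr (- real m)"
    using \<omega> by (simp add: norm_power norm_divide power_divide powr_minus powr_realpow inverse_eq_divide)
  have "eventually (\<lambda>T. norm (?q ^ m * integral {1..T} (\<lambda>t. of_real (powr_deriv (real k - \<alpha>) m t) * cis (\<omega> * t)))
      \<le> \<omega> powr (- real m) * (\<bar>?p\<bar> * (2 / \<omega>))) at_top"
    using eventually_ge_at_top[of 1]
  proof eventually_elim
    case (elim T)
    have "integral {1..T} (\<lambda>t. of_real (powr_deriv (real k - \<alpha>) m t) * cis (\<omega> * t))
       = of_real ?p * integral {1..T} (\<lambda>t. of_real (t powr (real k - \<alpha> - real m)) * cis (\<omega> * t))"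
      unfolding powr_deriv_def of_real_mult mult.assoc by (rule integral_mult_right)
    also have "norm \<dots> \<le> \<bar>?p\<bar> * (2 / \<omega>)"
      unfolding norm_mult norm_of_real
      by (intro mult_left_mono norm_oscillatory_powr_integral_le) (use assms elim in auto)
    finally show ?case unfolding norm_mult[of "?q ^ m"] q by (intro mult_left_mono) auto
  qed
  thus ?thesis
    unfolding X_def by (intro Lim_norm_ubound[OF _ power_tail_limit[OF assms(1-4)]]) auto
qed

text \<open>
The finite part of the integral of \<open>t\<^bsup>-\<alpha>-1\<^esup> e\<^bsup>i\<omega>t\<^esup>\<close> over \<open>(0,\<infinity>)\<close>.
\<close>
definition leading_power_integral :: "real \<Rightarrow> real \<Rightarrow> complex" where
  "leading_power_integral \<omega> \<alpha> =
     (if \<alpha> = 0 then \<i> * of_real (pi / 2) - euler_mascheroni - of_real (ln \<omega>)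
      else exp (of_real (pi / 2 * (2 - \<alpha>)) * \<i>) * of_real (\<omega> powr \<alpha>) / of_real \<alpha> * of_real (Gamma (1 - \<alpha>)))"

text \<open>
For \<open>\<alpha> > 0\<close> one integration by parts reduces the exponent \<open>-\<alpha>-1\<close> to \<open>-\<alpha>\<close>, and the boundary term at \<open>x\<close> is the
divergent \<open>x\<^bsup>-\<alpha>\<^esup>/\<alpha>\<close> up to \<open>o(1)\<close>. For \<open>\<alpha> = 0\<close> the divergence is logarithmic.
\<close>
lemma leading_finite_part:
  assumes "0 \<le> \<alpha>" "\<alpha> < 1" "\<omega> > 0"
  obtains \<beta> c k C J where "\<beta> > 0"
    "((\<lambda>x. integral {x..1} (\<lambda>t. of_real (t powr (-\<alpha> - 1)) * cis (\<omega> * t))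
        - (c * of_real (x powr (-\<beta>)) + k * of_real (ln x))) \<longlongrightarrow> C) (at_right 0)"
    "((\<lambda>T. integral {1..T} (\<lambda>t. of_real (t powr (-\<alpha> - 1)) * cis (\<omega> * t))) \<longlongrightarrow> J) at_top"
    "C + J = leading_power_integral \<omega> \<alpha>"
proof (cases "\<alpha> = 0")
  case True
  obtain C J where CJ:
    "((\<lambda>x. integral {x..1} (\<lambda>t. of_real (t powr (-1)) * cis (\<omega> * t)) + of_real (ln x)) \<longlongrightarrow> C) (at_right 0)"
    "((\<lambda>T. integral {1..T} (\<lambda>t. of_real (t powr (-1)) * cis (\<omega> * t))) \<longlongrightarrow> J) at_top"
    "C + J = \<i> * of_real (pi / 2) - euler_mascheroni - of_real (ln \<omega>)"
    by (rule oscillatory_inverse_integral[OF assms(3)])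
  show ?thesis
    \<comment> \<open>Only the logarithm diverges: the power gets the coefficient 0, and its exponent 1 is arbitrary.\<close>
    by (rule that[of 1 0 "-1" C J]) (use CJ True in \<open>auto simp: leading_power_integral_def\<close>)
next
  case False
  hence \<alpha>: "0 < \<alpha>" using assms by simp
  let ?I = "\<lambda>p x y. integral {x..y} (\<lambda>t. complex_of_real (t powr p) * cis (\<omega> * t))"
  obtain C J where CJ: "((\<lambda>x. ?I (-\<alpha>) x 1) \<longlongrightarrow> C) (at_right 0)" "((\<lambda>T. ?I (-\<alpha>) 1 T) \<longlongrightarrow> J) at_top"
    "C + J = abel_power_integral \<omega> (-\<alpha>)"
    by (rule oscillatory_power_integral[OF \<alpha> assms(2,3)])
  let ?d = "\<i> * complex_of_real \<omega> / of_real \<alpha>"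
  let ?e = "\<lambda>t. complex_of_real (t powr (-\<alpha>) / \<alpha>) * cis (\<omega> * t)"
  have rec: "?I (-\<alpha> - 1) x y = ?e x - ?e y + ?d * ?I (-\<alpha>) x y" if "0 < x" "x \<le> y" for x y
  proof -
    have "?I (-\<alpha>) x y = boundary_sum \<omega> 1 (powr_deriv (-\<alpha>)) y - boundary_sum \<omega> 1 (powr_deriv (-\<alpha>)) x
       + (\<i> / of_real \<omega>) * integral {x..y} (\<lambda>t. of_real (powr_deriv (-\<alpha>) 1 t) * cis (\<omega> * t))"
      using integral_by_parts_chain[OF deriv_chain_powr[of 1 "-\<alpha>"] _ that, of \<omega>] assms(3) by simp
    also have "integral {x..y} (\<lambda>t. of_real (powr_deriv (-\<alpha>) 1 t) * cis (\<omega> * t)) = - of_real \<alpha> * ?I (-\<alpha> - 1) x y"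
      unfolding integral_mult_right[symmetric] by (simp add: powr_deriv_def mult.assoc)
    finally have "?I (-\<alpha>) x y = - (\<i> / of_real \<omega>) * of_real (y powr (-\<alpha>)) * cis (\<omega> * y)
        + (\<i> / of_real \<omega>) * of_real (x powr (-\<alpha>)) * cis (\<omega> * x) - (\<i> / of_real \<omega>) * of_real \<alpha> * ?I (-\<alpha> - 1) x y"
      by (simp add: boundary_sum_def)
    moreover have "- p * A * B + p * C * D - p * E * N = p * (C * D - A * B - E * N)" for p A B C D E N :: complex
      by (simp add: algebra_simps)
    ultimately have "?I (-\<alpha>) x y = (\<i> / of_real \<omega>) *
       (of_real (x powr (-\<alpha>)) * cis (\<omega> * x) - of_real (y powr (-\<alpha>)) * cis (\<omega> * y) - of_real \<alpha> * ?I (-\<alpha> - 1) x y)"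
      by (simp only:)
    hence "?d * ?I (-\<alpha>) x y = ?d * (\<i> / of_real \<omega>) *
       (of_real (x powr (-\<alpha>)) * cis (\<omega> * x) - of_real (y powr (-\<alpha>)) * cis (\<omega> * y) - of_real \<alpha> * ?I (-\<alpha> - 1) x y)"
      by (simp only: mult.assoc)
    also have "?d * (\<i> / of_real \<omega>) = - (1 / of_real \<alpha>)" using assms(3) by simp
    also have "- (1 / of_real \<alpha>) *
       (of_real (x powr (-\<alpha>)) * cis (\<omega> * x) - of_real (y powr (-\<alpha>)) * cis (\<omega> * y) - of_real \<alpha> * ?I (-\<alpha> - 1) x y)
       = ?e y - ?e x + ?I (-\<alpha> - 1) x y"
      using \<alpha> by (simp add: algebra_simps)
    finally show ?thesis by simp
  qed
  have osc: "((\<lambda>x. ?e x - of_real (x powr (-\<alpha>) / \<alpha>)) \<longlongrightarrow> 0) (at_right 0)"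
  proof (rule Lim_null_comparison)
    show "eventually (\<lambda>x. norm (?e x - of_real (x powr (-\<alpha>) / \<alpha>)) \<le> x powr (-\<alpha>) / \<alpha> * (\<omega> * x)) (at_right 0)"
      using eventually_at_right_less[of 0]
    proof eventually_elim
      case (elim x)
      have "norm (cis (\<omega> * x) - 1) \<le> norm (\<i> * of_real (\<omega> * x))"
        unfolding cis_conv_exp by (rule norm_exp_minus_1_le) simp
      hence n: "norm (cis (\<omega> * x) - 1) \<le> \<omega> * x" using elim assms(3) by (simp add: norm_mult)
      have "?e x - of_real (x powr (-\<alpha>) / \<alpha>) = of_real (x powr (-\<alpha>) / \<alpha>) * (cis (\<omega> * x) - 1)"
        by (simp add: right_diff_distrib)
      also have "norm \<dots> = x powr (-\<alpha>) / \<alpha> * norm (cis (\<omega> * x) - 1)"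
        using \<alpha> by (simp only: norm_mult norm_of_real) simp
      also have "\<dots> \<le> x powr (-\<alpha>) / \<alpha> * (\<omega> * x)" using n \<alpha> by (intro mult_left_mono) auto
      finally show ?case .
    qed
    show "((\<lambda>x. x powr (-\<alpha>) / \<alpha> * (\<omega> * x)) \<longlongrightarrow> 0) (at_right 0)"
      using assms \<alpha> by real_asymp
  qed
  have "((\<lambda>x. (?e x - of_real (x powr (-\<alpha>) / \<alpha>)) - ?e 1 + ?d * ?I (-\<alpha>) x 1) \<longlongrightarrow> 0 - ?e 1 + ?d * C) (at_right 0)"
    by (intro tendsto_add[OF tendsto_diff[OF osc tendsto_const]] tendsto_mult[OF tendsto_const] CJ)
  moreover have "eventually (\<lambda>x. (?e x - of_real (x powr (-\<alpha>) / \<alpha>)) - ?e 1 + ?d * ?I (-\<alpha>) x 1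
     = ?I (-\<alpha> - 1) x 1 - (of_real (1 / \<alpha>) * of_real (x powr (-\<alpha>)) + 0 * of_real (ln x))) (at_right 0)"
    using eventually_at_right_real[OF zero_less_one]
  proof eventually_elim
    case (elim x)
    show ?case using rec[of x 1] elim by simp
  qed
  ultimately have 1: "((\<lambda>x. ?I (-\<alpha> - 1) x 1 - (of_real (1 / \<alpha>) * of_real (x powr (-\<alpha>)) + 0 * of_real (ln x)))
      \<longlongrightarrow> 0 - ?e 1 + ?d * C) (at_right 0)"
    by (rule Lim_transform_eventually)
  have e0: "(?e \<longlongrightarrow> 0) at_top"
  proof (rule Lim_null_comparison)
    show "eventually (\<lambda>x. norm (?e x) \<le> x powr (-\<alpha>) / \<alpha>) at_top"
      unfolding norm_mult norm_of_real norm_cis using \<alpha> by simp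
    show "((\<lambda>x. x powr (-\<alpha>) / \<alpha>) \<longlongrightarrow> 0) at_top" using \<alpha> by real_asymp
  qed
  have "((\<lambda>T. ?e 1 - ?e T + ?d * ?I (-\<alpha>) 1 T) \<longlongrightarrow> ?e 1 - 0 + ?d * J) at_top"
    by (intro tendsto_add[OF tendsto_diff[OF tendsto_const e0]] tendsto_mult[OF tendsto_const] CJ)
  moreover have "eventually (\<lambda>T. ?e 1 - ?e T + ?d * ?I (-\<alpha>) 1 T = ?I (-\<alpha> - 1) 1 T) at_top"
    using eventually_ge_at_top[of 1] by eventually_elim (simp only: rec[symmetric] zero_less_one)
  ultimately have 2: "((\<lambda>T. ?I (-\<alpha> - 1) 1 T) \<longlongrightarrow> ?e 1 - 0 + ?d * J) at_top"
    by (rule Lim_transform_eventually)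
  have "(0 - ?e 1 + ?d * C) + (?e 1 - 0 + ?d * J) = ?d * (C + J)"
    unfolding distrib_left[of ?d] by simp
  also have "\<dots> = leading_power_integral \<omega> \<alpha>"
  proof -
    have "\<i> * cis (pi / 2 * (-\<alpha> + 1)) = cis (pi / 2) * cis (pi / 2 * (-\<alpha> + 1))" by simp
    also have "\<dots> = cis (pi / 2 + pi / 2 * (-\<alpha> + 1))" by (rule cis_mult)
    also have "pi / 2 + pi / 2 * (-\<alpha> + 1) = pi / 2 * (2 - \<alpha>)" by (simp add: field_simps)
    finally have p: "exp (of_real (pi / 2 * (2 - \<alpha>)) * \<i>) = \<i> * cis (pi / 2 * (-\<alpha> + 1))"
      by (simp only: cis_conv_exp mult.commute)
    have "\<omega> powr \<alpha> = \<omega> / \<omega> powr (-\<alpha> + 1)"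
      using assms(3) powr_diff[of \<omega> 1 "-\<alpha> + 1"] by simp
    thus ?thesis unfolding CJ(3) leading_power_integral_def p abel_power_integral_def
      using False by (simp add: mult_ac)
  qed
  finally have "(0 - ?e 1 + ?d * C) + (?e 1 - 0 + ?d * J) = leading_power_integral \<omega> \<alpha>" .
  with 1 2 \<alpha> show ?thesis using that by blast
qed

section \<open>The asymptotic expansion\<close>

text \<open>
The remainder \<open>E\<close> gathers \<open>(i/\<omega>)\<^sup>m\<close> times the oscillatory integrals of the \<open>m\<close>-th derivatives and the tails \<open>X\<^sub>l\<close>
of the powers; the boundary terms at \<open>1\<close> cancel by linearity of \<open>boundary_sum\<close>.
\<close>
lemma fp_integral_expansion:
  fixes f :: "real \<Rightarrow> real" and a :: "nat \<Rightarrow> real" and \<alpha> :: real and m :: nat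
  defines "ftilde \<equiv> (\<lambda>t. (f t - a 0 * t powr (-\<alpha>)) / t)"
  assumes diff: "times_cont_differentiable_on m f {0<..}"
    and \<alpha>: "0 \<le> \<alpha>" "\<alpha> < 1"
    and expan: "\<forall>s\<le>m. diff_expansion_at_0 f a \<alpha> s"
    and conv: "\<forall>s\<le>m. \<exists>\<omega>\<^sub>0. improper_integral_uniformly_convergent
           (\<lambda>\<omega> t. of_real ((deriv ^^ s) ftilde t) * exp (\<i> * of_real (\<omega> * t))) 1 {\<omega>\<^sub>0..}"
  obtains E :: "real \<Rightarrow> complex" and \<Omega> :: real where
    "\<And>\<omega>. \<omega> \<ge> \<Omega> \<Longrightarrow> has_fp_integral (\<lambda>t. exp (\<i> * of_real (\<omega> * t)) * of_real (f t / t))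
       (of_real (a 0) * leading_power_integral \<omega> \<alpha>
        + (\<Sum>l=1..m. of_real (a l) * abel_power_integral \<omega> (real l - 1 - \<alpha>)) + E \<omega>)"
    "E \<in> o[at_top](\<lambda>\<omega>. of_real (\<omega> powr (- real m)))"
proof -
  define D where "D s = (deriv ^^ s) f" for s
  have D: "deriv_chain m D"
    unfolding deriv_chain_def D_def
    using diff by (auto simp: times_cont_differentiable_on_def DERIV_deriv_iff_field_differentiable)
  define h where "h s t = D s t + (\<Sum>j\<le>m. - a j * powr_deriv (real j - \<alpha>) s t)" for s t
  have h: "deriv_chain m h"
    unfolding h_def[abs_def] by (intro deriv_chain_add_scaled_sum D deriv_chain_powr)
  \<comment> \<open>The expansion is used one term beyond what is subtracted: an error o(t^(m-\<alpha>-s)) would not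
    make the m-th derivative of h(t)/t integrable at 0.\<close>
  have h_bigo: "h s \<in> O[at_right 0](\<lambda>t. t powr (real m + 1 - \<alpha> - real s))" if "s \<le> m" for s
  proof -
    let ?g = "\<lambda>t. (deriv ^^ s) f t - (\<Sum>j\<le>Suc m. a j * (deriv ^^ s) (\<lambda>x. x powr (real j - \<alpha>)) t)"
    let ?r = "\<lambda>t. a (Suc m) * powr_deriv (real (Suc m) - \<alpha>) s t"
    have "?g \<in> o[at_right 0](\<lambda>t. t powr (real (Suc m) - \<alpha> - real s))"
      using expan that unfolding diff_expansion_at_0_def by blast
    hence "?g \<in> O[at_right 0](\<lambda>t. t powr (real (Suc m) - \<alpha> - real s))"
      by (rule landau_o.small_imp_big)
    moreover have "?r \<in> O[at_right 0](\<lambda>t. t powr (real (Suc m) - \<alpha> - real s))"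
      unfolding powr_deriv_def mult.assoc[symmetric] by simp
    ultimately have "(\<lambda>t. ?g t + ?r t) \<in> O[at_right 0](\<lambda>t. t powr (real (Suc m) - \<alpha> - real s))"
      by (rule sum_in_bigo)
    moreover have "eventually (\<lambda>t. ?g t + ?r t = h s t) (at_right 0)"
      using eventually_at_right_less[of 0]
    proof eventually_elim
      case (elim t)
      show ?case by (simp add: higher_deriv_powr[OF elim] h_def D_def sum_negf)
    qed
    ultimately have "h s \<in> O[at_right 0](\<lambda>t. t powr (real (Suc m) - \<alpha> - real s))"
      by (rule landau_o.big.in_cong[THEN iffD1, rotated])
    thus ?thesis by (simp add: add.commute)
  qed
  define R where "R = quotient_chain h"
  have R: "deriv_chain m R" unfolding R_def by (rule deriv_chain_quotient[OF h])
  have R_bigo: "R s \<in> O[at_right 0](\<lambda>t. t powr (real m - \<alpha> - real s))" if "s \<le> m" for s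
    using quotient_chain_bigo[of m h "real m + 1 - \<alpha>", OF h_bigo that] by (simp add: R_def algebra_simps)
  define ft where "ft s t = R s t + (\<Sum>l=1..m. a l * powr_deriv (real l - 1 - \<alpha>) s t)" for s t
  have ft: "deriv_chain m ft"
    unfolding ft_def[abs_def] by (intro deriv_chain_add_scaled_sum R deriv_chain_powr)
  have ft_0: "ft 0 t = ftilde t" if "t > 0" for t
  proof -
    have *: "a j * t powr (real j - \<alpha>) / t = a j * t powr (real j - 1 - \<alpha>)" for j
      using that powr_diff[of t "real j - \<alpha>" 1] by (simp add: algebra_simps)
    have "{..m} = insert 0 {1..m}" by auto
    hence "h 0 t = f t - a 0 * t powr (-\<alpha>) - (\<Sum>l=1..m. a l * t powr (real l - \<alpha>))"
      by (simp add: h_def D_def sum_negf)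
    hence "R 0 t = ftilde t - (\<Sum>l=1..m. a l * t powr (real l - \<alpha>)) / t"
      by (simp add: R_def ftilde_def diff_divide_distrib)
    also have "(\<Sum>l=1..m. a l * t powr (real l - \<alpha>)) / t = (\<Sum>l=1..m. a l * t powr (real l - 1 - \<alpha>))"
      unfolding sum_divide_distrib * ..
    finally show ?thesis by (simp add: ft_def)
  qed
  have ft_deriv: "(deriv ^^ s) ftilde t = ft s t" if "s \<le> m" "t > 0" for s t
    by (rule deriv_chain_unique[OF ft _ that]) (simp add: ft_0)
  let ?I = "\<lambda>u \<omega> x y. integral {x..y} (\<lambda>t. complex_of_real (u t) * cis (\<omega> * t))"
  have "\<exists>W J. (\<forall>\<omega>\<ge>W. ((\<lambda>T. ?I (ft s) \<omega> 1 T) \<longlongrightarrow> J \<omega>) at_top) \<and> (J \<longlongrightarrow> 0) at_top" if "s \<le> m" for s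
  proof -
    obtain W where "improper_integral_uniformly_convergent
           (\<lambda>\<omega> t. of_real ((deriv ^^ s) ftilde t) * exp (\<i> * of_real (\<omega> * t))) 1 {W..}"
      using conv \<open>s \<le> m\<close> by blast
    hence u: "improper_integral_uniformly_convergent (\<lambda>\<omega> t. of_real (ft s t) * cis (\<omega> * t)) 1 {W..}"
      by (subst (asm) improper_integral_uniformly_convergent_cong[where G = "\<lambda>\<omega> t. of_real (ft s t) * cis (\<omega> * t)"])
         (use that in \<open>auto simp: ft_deriv cis_conv_exp\<close>)
    have "continuous_on {1..} (ft s)"
      by (rule continuous_on_subset[OF deriv_chain_continuous[OF ft that]]) auto
    from uniform_improper_integral_vanishes[OF this u] show ?thesis by metis
  qed
  then obtain W J where WJ:
    "\<And>s \<omega>. s \<le> m \<Longrightarrow> \<omega> \<ge> W s \<Longrightarrow> ((\<lambda>T. ?I (ft s) \<omega> 1 T) \<longlongrightarrow> J s \<omega>) at_top"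
    "\<And>s. s \<le> m \<Longrightarrow> (J s \<longlongrightarrow> 0) at_top"
    by metis
  define \<Omega> where "\<Omega> = Max (insert 1 (W ` {..m}))"
  have \<Omega>: "1 \<le> \<Omega>" "\<And>s. s \<le> m \<Longrightarrow> W s \<le> \<Omega>" unfolding \<Omega>_def by (intro Max_ge; simp)+
  define q where "q \<omega> = \<i> / complex_of_real \<omega>" for \<omega>
  define K where "K \<omega> = ?I (R m) \<omega> 0 1" for \<omega>
  define X where "X l \<omega> = abel_power_integral \<omega> (real l - 1 - \<alpha>) - ?I (\<lambda>t. t powr (real l - 1 - \<alpha>)) \<omega> 0 1
     + boundary_sum \<omega> m (powr_deriv (real l - 1 - \<alpha>)) 1" for l \<omega>
  define E where "E \<omega> = q \<omega> ^ m * (K \<omega> + J m \<omega>) - (\<Sum>l=1..m. of_real (a l) * X l \<omega>)" for \<omega>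
  obtain C where C: "\<And>t. 0 < t \<Longrightarrow> t \<le> 1 \<Longrightarrow> \<bar>R m t\<bar> \<le> C * t powr (-\<alpha>)"
    using bigo_powr_bound_on_unit[of "R m" \<alpha>] R_bigo[of m] deriv_chain_continuous[OF R, of m] \<alpha> by auto
  have Rm_cont: "continuous_on {0<..1} (R m)"
    by (rule continuous_on_subset[OF deriv_chain_continuous[OF R]]) auto

  have fp: "has_fp_integral (\<lambda>t. exp (\<i> * of_real (\<omega> * t)) * of_real (f t / t))
       (of_real (a 0) * leading_power_integral \<omega> \<alpha>
        + (\<Sum>l=1..m. of_real (a l) * abel_power_integral \<omega> (real l - 1 - \<alpha>)) + E \<omega>)" if "\<omega> \<ge> \<Omega>" for \<omega>
  proof -
    have \<omega>: "\<omega> > 0" "\<omega> \<noteq> 0" using \<Omega>(1) that by auto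
    let ?F = "\<lambda>t. exp (\<i> * of_real (\<omega> * t)) * complex_of_real (f t / t)"
    let ?b = "boundary_sum \<omega> m"
    have J: "((\<lambda>T. ?I (ft s) \<omega> 1 T) \<longlongrightarrow> J s \<omega>) at_top" if "s \<le> m" for s
      using WJ(1)[OF that] \<Omega>(2)[OF that] \<open>\<omega> \<ge> \<Omega>\<close> by simp
    have "((\<lambda>T. ?b ft T - ?b ft 1 + q \<omega> ^ m * ?I (ft m) \<omega> 1 T) \<longlongrightarrow> 0 - ?b ft 1 + q \<omega> ^ m * J m \<omega>) at_top"
      by (intro tendsto_intros boundary_sum_tendsto_0 deriv_chain_vanishes_at_top[OF ft \<omega>(2)] J) (use J in auto)
    moreover have "eventually (\<lambda>T. ?b ft T - ?b ft 1 + q \<omega> ^ m * ?I (ft m) \<omega> 1 T = ?I (ft 0) \<omega> 1 T) at_top"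
      using eventually_ge_at_top[of 1]
      by eventually_elim (simp only: q_def integral_by_parts_chain[OF ft \<omega>(2) zero_less_one])
    ultimately have ft_inf: "((\<lambda>T. ?I (ft 0) \<omega> 1 T) \<longlongrightarrow> 0 - ?b ft 1 + q \<omega> ^ m * J m \<omega>) at_top"
      by (rule Lim_transform_eventually)
    have "(\<lambda>t. of_real (R m t) * cis (\<omega> * t)) integrable_on {0..1}"
      by (rule integrable_singular_at_0[OF \<alpha>(2) Rm_cont C])
    hence "((\<lambda>x. ?b R 1 - ?b R x + q \<omega> ^ m * ?I (R m) \<omega> x 1) \<longlongrightarrow> ?b R 1 - 0 + q \<omega> ^ m * K \<omega>) (at_right 0)"
      unfolding K_def
      by (intro tendsto_intros boundary_sum_tendsto_0 tendsto_integral_at_right_0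
            bigo_powr_tendsto_0[OF R_bigo]) (use \<alpha> in auto)
    moreover have "eventually (\<lambda>x. ?b R 1 - ?b R x + q \<omega> ^ m * ?I (R m) \<omega> x 1 = ?I (R 0) \<omega> x 1) (at_right 0)"
      using eventually_at_right_real[OF zero_less_one]
      by eventually_elim (use integral_by_parts_chain[OF R \<omega>(2)] in \<open>simp add: q_def\<close>)
    ultimately have R_0: "((\<lambda>x. ?I (R 0) \<omega> x 1) \<longlongrightarrow> ?b R 1 - 0 + q \<omega> ^ m * K \<omega>) (at_right 0)"
      by (rule Lim_transform_eventually)
    have pw: "((\<lambda>x. ?I (\<lambda>t. t powr (real l - 1 - \<alpha>)) \<omega> x 1) \<longlongrightarrow> ?I (\<lambda>t. t powr (real l - 1 - \<alpha>)) \<omega> 0 1) (at_right 0)"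
      if "l \<in> {1..m}" for l
      by (rule tendsto_integral_at_right_0, rule oscillatory_power_integrable) (use that \<alpha> in auto)
    obtain \<beta> c k Cl Jl where lead: "\<beta> > 0"
      "((\<lambda>x. ?I (\<lambda>t. t powr (-\<alpha> - 1)) \<omega> x 1 - (c * of_real (x powr (-\<beta>)) + k * of_real (ln x))) \<longlongrightarrow> Cl) (at_right 0)"
      "((\<lambda>T. ?I (\<lambda>t. t powr (-\<alpha> - 1)) \<omega> 1 T) \<longlongrightarrow> Jl) at_top"
      "Cl + Jl = leading_power_integral \<omega> \<alpha>"
      by (rule leading_finite_part[OF \<alpha> \<omega>(1)])
    have F: "?F t = of_real (a 0) * (of_real (t powr (-\<alpha> - 1)) * cis (\<omega> * t)) + of_real (ft 0 t) * cis (\<omega> * t)"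
      if "t > 0" for t
    proof -
      have "t powr (-\<alpha> - 1) = t powr (-\<alpha>) / t" using that powr_diff[of t "-\<alpha>" 1] by simp
      hence "f t / t = a 0 * t powr (-\<alpha> - 1) + ft 0 t"
        using that by (simp add: ft_0 ftilde_def diff_divide_distrib)
      hence "?F t = cis (\<omega> * t) * of_real (a 0 * t powr (-\<alpha> - 1) + ft 0 t)" by (simp only: cis_conv_exp)
      thus ?thesis by (simp add: algebra_simps)
    qed
    have cpow: "continuous_on {x..y} (\<lambda>t. complex_of_real (t powr p) * cis (\<omega> * t))" if "x > 0" for p x y
      using that by (intro continuous_intros) auto
    have cft: "continuous_on {x..y} (\<lambda>t. complex_of_real (ft 0 t) * cis (\<omega> * t))" if "x > 0" for x y
      using that by (intro deriv_chain_continuous_ivl[OF ft]) auto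
    have cR: "continuous_on {x..y} (\<lambda>t. complex_of_real (R 0 t) * cis (\<omega> * t))" if "x > 0" for x y
      using that by (intro deriv_chain_continuous_ivl[OF R]) auto
    have split: "integral {x..y} ?F = of_real (a 0) * ?I (\<lambda>t. t powr (-\<alpha> - 1)) \<omega> x y + ?I (ft 0) \<omega> x y" if "x > 0" for x y
    proof -
      have "integral {x..y} ?F = integral {x..y} (\<lambda>t. of_real (a 0) * (of_real (t powr (-\<alpha> - 1)) * cis (\<omega> * t)) + of_real (ft 0 t) * cis (\<omega> * t))"
        by (rule Henstock_Kurzweil_Integration.integral_cong, rule F) (use that in auto)
      also have "\<dots> = of_real (a 0) * ?I (\<lambda>t. t powr (-\<alpha> - 1)) \<omega> x y + ?I (ft 0) \<omega> x y"
        using that by (subst integral_add)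
          (auto intro!: integrable_continuous_real continuous_on_mult continuous_on_const cpow cft)
      finally show ?thesis .
    qed
    have split_ft: "?I (ft 0) \<omega> x y = ?I (R 0) \<omega> x y + (\<Sum>l=1..m. of_real (a l) * ?I (\<lambda>t. t powr (real l - 1 - \<alpha>)) \<omega> x y)"
      if "x > 0" for x y
    proof -
      have "?I (ft 0) \<omega> x y = integral {x..y} (\<lambda>t. of_real (R 0 t) * cis (\<omega> * t)
          + (\<Sum>l=1..m. of_real (a l) * (of_real (t powr (real l - 1 - \<alpha>)) * cis (\<omega> * t))))"
        by (rule Henstock_Kurzweil_Integration.integral_cong)
           (simp add: ft_def distrib_right sum_distrib_right mult.assoc)
      also have "\<dots> = ?I (R 0) \<omega> x y + integral {x..y} (\<lambda>t. \<Sum>l=1..m. of_real (a l) * (of_real (t powr (real l - 1 - \<alpha>)) * cis (\<omega> * t)))"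
        using that by (intro integral_add integrable_continuous_real continuous_on_sum continuous_on_mult continuous_on_const cpow cR)
      also have "integral {x..y} (\<lambda>t. \<Sum>l=1..m. of_real (a l) * (of_real (t powr (real l - 1 - \<alpha>)) * cis (\<omega> * t)))
          = (\<Sum>l=1..m. of_real (a l) * ?I (\<lambda>t. t powr (real l - 1 - \<alpha>)) \<omega> x y)"
        using that by (subst integral_sum)
          (auto intro!: integrable_continuous_real continuous_on_mult continuous_on_const cpow)
      finally show ?thesis .
    qed
    \<comment> \<open>The finite part over (0,1) and the improper integral over (1,\<infinity>).\<close>
    let ?C = "of_real (a 0) * Cl + ((?b R 1 - 0 + q \<omega> ^ m * K \<omega>)
        + (\<Sum>l=1..m. of_real (a l) * ?I (\<lambda>t. t powr (real l - 1 - \<alpha>)) \<omega> 0 1))"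
    let ?J = "of_real (a 0) * Jl + (0 - ?b ft 1 + q \<omega> ^ m * J m \<omega>)"
    have "has_fp_integral ?F (?C + ?J)"
    proof (rule has_fp_integralI[OF _ lead(1)])
      have "continuous_on {0<..} f"
        using deriv_chain_continuous[OF D, of 0] by (simp add: D_def)
      thus "continuous_on {0<..} ?F"
        by (intro continuous_intros) auto
      have "((\<lambda>T. of_real (a 0) * ?I (\<lambda>t. t powr (-\<alpha> - 1)) \<omega> 1 T + ?I (ft 0) \<omega> 1 T) \<longlongrightarrow> ?J) at_top"
        by (intro tendsto_add ft_inf tendsto_mult[OF tendsto_const] lead)
      thus "((\<lambda>T. integral {1..T} ?F) \<longlongrightarrow> ?J) at_top" by (simp only: split zero_less_one)
      have "((\<lambda>x. of_real (a 0) * (?I (\<lambda>t. t powr (-\<alpha> - 1)) \<omega> x 1 - (c * of_real (x powr (-\<beta>)) + k * of_real (ln x)))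
         + (?I (R 0) \<omega> x 1 + (\<Sum>l=1..m. of_real (a l) * ?I (\<lambda>t. t powr (real l - 1 - \<alpha>)) \<omega> x 1))) \<longlongrightarrow> ?C) (at_right 0)"
        by (intro tendsto_add[OF tendsto_mult[OF tendsto_const lead(2)]] tendsto_add[OF R_0] tendsto_sum tendsto_mult[OF tendsto_const] pw)
      moreover have "eventually (\<lambda>x. of_real (a 0) * (?I (\<lambda>t. t powr (-\<alpha> - 1)) \<omega> x 1 - (c * of_real (x powr (-\<beta>)) + k * of_real (ln x)))
         + (?I (R 0) \<omega> x 1 + (\<Sum>l=1..m. of_real (a l) * ?I (\<lambda>t. t powr (real l - 1 - \<alpha>)) \<omega> x 1))
         = integral {x..1} ?F - (of_real (a 0) * c * of_real (x powr (-\<beta>)) + of_real (a 0) * k * of_real (ln x))) (at_right 0)"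
        using eventually_at_right_less[of 0]
      proof eventually_elim
        case (elim x)
        show ?case unfolding split[OF elim] split_ft[OF elim] by (simp only: algebra_simps)
      qed
      ultimately show "((\<lambda>x. integral {x..1} ?F - (of_real (a 0) * c * of_real (x powr (-\<beta>)) + of_real (a 0) * k * of_real (ln x)))
          \<longlongrightarrow> ?C) (at_right 0)"
        by (rule Lim_transform_eventually)
    qed
    also have "?C + ?J = of_real (a 0) * leading_power_integral \<omega> \<alpha>
        + (\<Sum>l=1..m. of_real (a l) * abel_power_integral \<omega> (real l - 1 - \<alpha>)) + E \<omega>"
    proof -
      have b: "?b ft 1 = ?b R 1 + (\<Sum>l=1..m. of_real (a l) * ?b (powr_deriv (real l - 1 - \<alpha>)) 1)"
        unfolding ft_def[abs_def] by (rule boundary_sum_add_scaled_sum)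
      have "(\<Sum>l=1..m. of_real (a l) * X l \<omega>) = (\<Sum>l=1..m. of_real (a l) * abel_power_integral \<omega> (real l - 1 - \<alpha>))
        - (\<Sum>l=1..m. of_real (a l) * ?I (\<lambda>t. t powr (real l - 1 - \<alpha>)) \<omega> 0 1)
        + (\<Sum>l=1..m. of_real (a l) * ?b (powr_deriv (real l - 1 - \<alpha>)) 1)"
        unfolding X_def by (simp only: distrib_left right_diff_distrib sum.distrib sum_subtractf)
      thus ?thesis unfolding E_def b lead(4)[symmetric] by (simp add: algebra_simps)
    qed
    finally show ?thesis .
  qed

  have small: "E \<in> o[at_top](\<lambda>\<omega>. of_real (\<omega> powr (- real m)))"
  proof (rule smalloI_tendsto)
    let ?p = "\<lambda>l. \<bar>\<Prod>i<m. real l - 1 - \<alpha> - real i\<bar>"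
    show "((\<lambda>\<omega>. E \<omega> / of_real (\<omega> powr (- real m))) \<longlongrightarrow> 0) at_top"
    proof (rule Lim_null_comparison)
      show "eventually (\<lambda>\<omega>. norm (E \<omega> / of_real (\<omega> powr (- real m)))
         \<le> norm (K \<omega>) + norm (J m \<omega>) + (\<Sum>l=1..m. \<bar>a l\<bar> * (?p l * (2 / \<omega>)))) at_top"
        using eventually_gt_at_top[of 0]
      proof eventually_elim
        case (elim \<omega>)
        let ?w = "\<omega> powr (- real m)"
        have w: "?w > 0" using elim by simp
        have q: "norm (q \<omega> ^ m) = ?w"
          using elim by (simp add: q_def norm_power norm_divide power_divide powr_minus powr_realpow inverse_eq_divide)
        have X: "norm (X l \<omega>) \<le> ?w * (?p l * (2 / \<omega>))" if "l \<in> {1..m}" for l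
        proof -
          have l: "real (l - 1) = real l - 1" "l - 1 < m" using that by auto
          show ?thesis using norm_power_tail_le[OF \<alpha> elim l(2)] unfolding X_def l(1) .
        qed
        have "norm (E \<omega>) \<le> norm (q \<omega> ^ m * (K \<omega> + J m \<omega>)) + norm (\<Sum>l=1..m. of_real (a l) * X l \<omega>)"
          unfolding E_def by (rule norm_triangle_ineq4)
        also have "norm (q \<omega> ^ m * (K \<omega> + J m \<omega>)) \<le> ?w * (norm (K \<omega>) + norm (J m \<omega>))"
          unfolding norm_mult q by (intro mult_left_mono norm_triangle_ineq) auto
        also have "norm (\<Sum>l=1..m. of_real (a l) * X l \<omega>) \<le> (\<Sum>l=1..m. \<bar>a l\<bar> * (?w * (?p l * (2 / \<omega>))))"
        proof (rule sum_norm_le)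
          fix l assume "l \<in> {1..m}"
          from mult_left_mono[OF X[OF this] abs_ge_zero[of "a l"]]
          show "norm (of_real (a l) * X l \<omega>) \<le> \<bar>a l\<bar> * (?w * (?p l * (2 / \<omega>)))"
            unfolding norm_mult[of "of_real (a l)"] norm_of_real .
        qed
        also have "(\<Sum>l=1..m. \<bar>a l\<bar> * (?w * (?p l * (2 / \<omega>)))) = ?w * (\<Sum>l=1..m. \<bar>a l\<bar> * (?p l * (2 / \<omega>)))"
          unfolding sum_distrib_left by (intro sum.cong refl) (simp only: mult_ac)
        finally have "norm (E \<omega>) \<le> (norm (K \<omega>) + norm (J m \<omega>) + (\<Sum>l=1..m. \<bar>a l\<bar> * (?p l * (2 / \<omega>)))) * ?w"
          by (simp add: algebra_simps)
        thus ?case using w by (simp add: norm_divide pos_divide_le_eq)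
      qed
      have K0: "(K \<longlongrightarrow> 0) at_top"
        unfolding K_def by (rule riemann_lebesgue_singular_at_0[OF \<alpha>(2) Rm_cont C])
      have "((\<lambda>\<omega>::real. 2 / \<omega>) \<longlongrightarrow> 0) at_top" by real_asymp
      hence "((\<lambda>\<omega>. norm (K \<omega>) + norm (J m \<omega>) + (\<Sum>l=1..m. \<bar>a l\<bar> * (?p l * (2 / \<omega>))))
         \<longlongrightarrow> 0 + 0 + (\<Sum>l=1..m. \<bar>a l\<bar> * (?p l * 0))) at_top"
        by (intro tendsto_add tendsto_norm_zero K0 WJ(2) tendsto_sum tendsto_mult tendsto_const) auto
      thus "((\<lambda>\<omega>. norm (K \<omega>) + norm (J m \<omega>) + (\<Sum>l=1..m. \<bar>a l\<bar> * (?p l * (2 / \<omega>)))) \<longlongrightarrow> 0) at_top"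
        by simp
    qed
    show "eventually (\<lambda>\<omega>. complex_of_real (\<omega> powr (- real m)) \<noteq> 0) at_top"
      using eventually_gt_at_top[of 0] by eventually_elim simp
  qed
  show ?thesis by (rule that[OF fp small])
qed

theorem theorem2p7:
  fixes f :: "real \<Rightarrow> real" and a :: "nat \<Rightarrow> real" and \<alpha> :: real and m :: nat
    and ftilde :: "real \<Rightarrow> real"
  defines "ftilde \<equiv> (\<lambda>t. (f t - a 0 * t powr (-\<alpha>)) / t)"
  assumes "m \<ge> 1"
    and "locally_integrable_on f {0..}"
    and "times_cont_differentiable_on m f {0<..}"
    and "0 \<le> \<alpha>" "\<alpha> < 1"
    and "\<forall>s\<le>m. diff_expansion_at_0 f a \<alpha> s"
    and "\<forall>s\<le>m. \<exists>\<omega>0. improper_integral_uniformly_convergent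
           (\<lambda>\<omega> t. of_real ((deriv ^^ s) ftilde t) * exp (\<i> * of_real (\<omega> * t))) 1 {\<omega>0..}"
  shows "(\<forall>\<^sub>F \<omega> in at_top. \<exists>I. has_fp_integral (\<lambda>t. exp (\<i> * of_real (\<omega> * t)) * of_real (f t / t)) I) \<and>
    (0 < \<alpha> \<longrightarrow>
      (\<lambda>\<omega>. fp_integral (\<lambda>t. exp (\<i> * of_real (\<omega> * t)) * of_real (f t / t)) -
        (exp (of_real (pi / 2 * (2 - \<alpha>)) * \<i>) * of_real (\<omega> powr \<alpha>) / of_real \<alpha>
            * of_real (Gamma (1 - \<alpha>)) * of_real (a 0)
         + (\<Sum>l=1..m. of_real (a l) * exp (of_real (pi / 2 * (real l - \<alpha>)) * \<i>)
              * of_real (Gamma (real l - \<alpha>) / \<omega> powr (real l - \<alpha>)))))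
      \<in> o[at_top](\<lambda>\<omega>. of_real (\<omega> powr (- real m)) :: complex)) \<and>
    (\<alpha> = 0 \<longrightarrow>
      (\<lambda>\<omega>. fp_integral (\<lambda>t. exp (\<i> * of_real (\<omega> * t)) * of_real (f t / t)) -
        ((\<i> * of_real (pi / 2) - euler_mascheroni - of_real (ln \<omega>)) * of_real (a 0)
         + (\<Sum>l=1..m. of_real (a l) * exp (of_real (pi * real l / 2) * \<i>)
              * of_real (fact (l - 1) / \<omega> ^ l))))
      \<in> o[at_top](\<lambda>\<omega>. of_real (\<omega> powr (- real m)) :: complex))"
proof -
  let ?F = "\<lambda>\<omega> t. exp (\<i> * of_real (\<omega> * t)) * complex_of_real (f t / t)"
  let ?T = "\<lambda>\<omega> l. of_real (a l) * exp (of_real (pi / 2 * (real l - \<alpha>)) * \<i>)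
              * complex_of_real (Gamma (real l - \<alpha>) / \<omega> powr (real l - \<alpha>))"
  obtain E \<Omega> where fp: "\<And>\<omega>. \<omega> \<ge> \<Omega> \<Longrightarrow> has_fp_integral (?F \<omega>)
       (of_real (a 0) * leading_power_integral \<omega> \<alpha>
        + (\<Sum>l=1..m. of_real (a l) * abel_power_integral \<omega> (real l - 1 - \<alpha>)) + E \<omega>)"
    and E: "E \<in> o[at_top](\<lambda>\<omega>. of_real (\<omega> powr (- real m)))"
    using fp_integral_expansion[OF assms(4-7) assms(8)[unfolded ftilde_def]] by blast
  have T: "of_real (a l) * abel_power_integral \<omega> (real l - 1 - \<alpha>) = ?T \<omega> l" for \<omega> l
  proof -
    have "real l - 1 - \<alpha> + 1 = real l - \<alpha>" by simp
    thus ?thesis unfolding abel_power_integral_def cis_conv_exp by (simp only: mult_ac)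
  qed
  have ev: "eventually (\<lambda>\<omega>. E \<omega> = fp_integral (?F \<omega>) - (leading_power_integral \<omega> \<alpha> * of_real (a 0) + (\<Sum>l=1..m. ?T \<omega> l))) at_top"
    using eventually_ge_at_top[of \<Omega>]
  proof eventually_elim
    case (elim \<omega>)
    show ?case unfolding fp_integral_eqI[OF fp[OF elim]] T by (simp add: mult.commute)
  qed
  have main: "(\<lambda>\<omega>. fp_integral (?F \<omega>) - (leading_power_integral \<omega> \<alpha> * of_real (a 0) + (\<Sum>l=1..m. ?T \<omega> l)))
      \<in> o[at_top](\<lambda>\<omega>. of_real (\<omega> powr (- real m)))"
    using E ev by (rule landau_o.small.in_cong[THEN iffD1, rotated])
  show ?thesis
  proof (intro conjI impI)
    show "\<forall>\<^sub>F \<omega> in at_top. \<exists>I. has_fp_integral (?F \<omega>) I"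
      using eventually_ge_at_top[of \<Omega>] by eventually_elim (use fp in blast)
  next
    assume "0 < \<alpha>"
    thus "(\<lambda>\<omega>. fp_integral (?F \<omega>) -
        (exp (of_real (pi / 2 * (2 - \<alpha>)) * \<i>) * of_real (\<omega> powr \<alpha>) / of_real \<alpha>
            * of_real (Gamma (1 - \<alpha>)) * of_real (a 0) + (\<Sum>l=1..m. ?T \<omega> l)))
      \<in> o[at_top](\<lambda>\<omega>. of_real (\<omega> powr (- real m)) :: complex)"
      using main by (simp only: leading_power_integral_def less_imp_neq[symmetric] if_False)
  next
    assume \<alpha>: "\<alpha> = 0"
    have "eventually (\<lambda>\<omega>. fp_integral (?F \<omega>) - (leading_power_integral \<omega> \<alpha> * of_real (a 0) + (\<Sum>l=1..m. ?T \<omega> l))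
       = fp_integral (?F \<omega>) - ((\<i> * of_real (pi / 2) - euler_mascheroni - of_real (ln \<omega>)) * of_real (a 0)
         + (\<Sum>l=1..m. of_real (a l) * exp (of_real (pi * real l / 2) * \<i>)
              * of_real (fact (l - 1) / \<omega> ^ l)))) at_top"
      using eventually_gt_at_top[of 0]
    proof eventually_elim
      case (elim \<omega>)
      have "?T \<omega> l = of_real (a l) * exp (of_real (pi * real l / 2) * \<i>) * of_real (fact (l - 1) / \<omega> ^ l)"
        if "l \<in> {1..m}" for l
      proof -
        have "Gamma (1 + real (l - 1)) = fact (l - 1)" by (rule Gamma_fact)
        moreover have "1 + real (l - 1) = real l" using that by auto
        ultimately have G: "Gamma (real l) = fact (l - 1)" by (simp only:)
        show ?thesis using elim by (simp add: \<alpha> G powr_realpow)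
      qed
      hence "(\<Sum>l=1..m. ?T \<omega> l) = (\<Sum>l=1..m. of_real (a l) * exp (of_real (pi * real l / 2) * \<i>)
              * of_real (fact (l - 1) / \<omega> ^ l))" by (rule sum.cong[OF refl])
      moreover have "leading_power_integral \<omega> \<alpha> = \<i> * of_real (pi / 2) - euler_mascheroni - of_real (ln \<omega>)"
        using \<alpha> by (simp add: leading_power_integral_def)
      ultimately show ?case by (simp only:)
    qed
    with main show "(\<lambda>\<omega>. fp_integral (?F \<omega>) -
        ((\<i> * of_real (pi / 2) - euler_mascheroni - of_real (ln \<omega>)) * of_real (a 0)
         + (\<Sum>l=1..m. of_real (a l) * exp (of_real (pi * real l / 2) * \<i>)
              * of_real (fact (l - 1) / \<omega> ^ l))))
      \<in> o[at_top](\<lambda>\<omega>. of_real (\<omega> powr (- real m)) :: complex)"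
      by (rule landau_o.small.in_cong[THEN iffD1, rotated])
  qed
qed

end
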